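(* Let $\lambda>0$ and $\omega\in\mathbb R$ with $\omega\neq0$, let $n\ge2$, and consider the two-dimensional real analogue $Z_1(t)=m_1+Y_1(t)$, $Z_2(t)=m_2+Y_2(t)$ of the complex model $Z(t)=m+Y(t)$, with $Y$ the normalized stationary complex Ornstein-Uhlenbeck process with damping $\lambda$ and frequency $\omega$, observed in design points $0\le t_1<t_2<\dots<t_n$. Let $d_j:=t_{j+1}-t_j$, $j=1,\dots,n-1$. (a) The D-optimal design for the damping parameter $\lambda$ maximizing the Fisher information $\mathcal I_\lambda(n)$ does not exist within the class of admissible designs. (b) The D-optimal design for the frequency $\omega$ maximizing the Fisher information $\mathcal I_\omega(n)$ is equidistant with $$d_1=d_2=\dots=d_{n-1}=d_\lambda:=\frac1\lambda\Big(\frac{W(-2e^{-2})}{2}+1\Big)\approx\frac{0.7968}{\lambda},$$ where $W$ denotes the Lambert $W$-function (principal branch). (c) The D-optimal design for both covariance parameters, maximizing $\det(\mathcal I_{\lambda,\omega}(n))$, is equidistant with $$d_1=d_2=\dots=d_{n-1}=d^\circ/\lambda,$$ where $d^\circ\approx0.4930$ is the unique positive solution of $$1-d-2d\,e^{-2d}-e^{-4d}=0.$$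
   Context: $Y=Y_1+iY_2$ is the stationary solution of $dY(t)=-(\lambda-i\omega)Y(t)\,dt+\sigma\,d\mathcal W(t)$, where $\mathcal W=\mathcal W_1+i\mathcal W_2$ with $\mathcal W_1,\mathcal W_2$ independent standard Brownian motions, normalized so that $\sigma^2/(2\lambda)=1$ (so the variances of $Y_1(t),Y_2(t)$ equal $1$ for all values of $\lambda,\omega$). Thus $(Y_1(t),Y_2(t))^\top$ is a centered Gaussian process with, for $\tau\ge0$, $$\mathsf E\begin{bmatrix}Y_1(t+\tau)\\ Y_2(t+\tau)\end{bmatrix}\begin{bmatrix}Y_1(t)\\ Y_2(t)\end{bmatrix}^\top=e^{-\lambda\tau}\begin{bmatrix}\cos(\omega\tau)&-\sin(\omega\tau)\\ \sin(\omega\tau)&\cos(\omega\tau)\end{bmatrix}.$$ Let $C(n)=C(n;\lambda,\omega)$ be the $2n\times2n$ covariance matrix of $(Z_1(t_1),Z_2(t_1),\dots,Z_1(t_n),Z_2(t_n))^\top$, regarded as a function of $(\lambda,\omega)$. The Fisher information matrix on $(\lambda,\omega)$ is $$\mathcal I_{\lambda,\omega}(n)=\begin{bmatrix}\mathcal I_\lambda(n)&I_{\lambda,\omega}(n)\\ I_{\lambda,\omega}(n)&\mathcal I_\omega(n)\end{bmatrix},$$ $$\mathcal I_\lambda(n)=\tfrac12\operatorname{tr}\Big\{C^{-1}(n)\tfrac{\partial C(n)}{\partial\lambda}C^{-1}(n)\tfrac{\partial C(n)}{\partial\lambda}\Big\},\quad \mathcal I_\omega(n)=\tfrac12\operatorname{tr}\Big\{C^{-1}(n)\tfrac{\partial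 C(n)}{\partial\omega}C^{-1}(n)\tfrac{\partial C(n)}{\partial\omega}\Big\},$$ $$I_{\lambda,\omega}(n)=\tfrac12\operatorname{tr}\Big\{C^{-1}(n)\tfrac{\partial C(n)}{\partial\lambda}C^{-1}(n)\tfrac{\partial C(n)}{\partial\omega}\Big\}.$$ These quantities depend on the design only through $(d_1,\dots,d_{n-1})$. Admissible designs are sets of $n$ distinct points $0\le t_1<\dots<t_n$ (equivalently $d_1,\dots,d_{n-1}>0$); a D-optimal design is one maximizing the indicated criterion over admissible designs, for the given values of $\lambda,\omega$. The Lambert $W$-function $W$ is the inverse of $w\mapsto we^w$; the principal branch has values $\ge-1$ on $[-e^{-1},\infty)$. *)

theory Defs
  imports
    "HOL-Probability.Probability"
    "Jordan_Normal_Form.Determinant"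
    "Jordan_Normal_Form.Gauss_Jordan_Elimination"
begin

subsection \<open>The stationary complex Ornstein--Uhlenbeck process\<close>

definition standard_brownian_motion :: "'a measure \<Rightarrow> (real \<Rightarrow> 'a \<Rightarrow> real) \<Rightarrow> bool" where
  "standard_brownian_motion M W \<longleftrightarrow>
     prob_space M \<and>
     (\<forall>t\<ge>0. W t \<in> borel_measurable M) \<and>
     (AE x in M. W 0 x = 0) \<and>
     (\<forall>(n::nat) (s :: nat \<Rightarrow> real). 0 \<le> s 0 \<and> (\<forall>i<n. s i < s (Suc i)) \<longrightarrow>
        prob_space.indep_vars M (\<lambda>_. borel) (\<lambda>i x. W (s (Suc i)) x - W (s i) x) {..<n}) \<and>
     (\<forall>s t. 0 \<le> s \<and> s < t \<longrightarrow>
        distributed M lborel (\<lambda>x. W t x - W s x)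
          (\<lambda>u. ennreal (normal_density 0 (sqrt (t - s)) u))) \<and>
     (AE x in M. continuous_on {0..} (\<lambda>t. W t x))"

definition complex_brownian_motion :: "'a measure \<Rightarrow> (real \<Rightarrow> 'a \<Rightarrow> complex) \<Rightarrow> bool" where
  "complex_brownian_motion M W \<longleftrightarrow>
     standard_brownian_motion M (\<lambda>t x. Re (W t x)) \<and>
     standard_brownian_motion M (\<lambda>t x. Im (W t x)) \<and>
     prob_space.indep_var M
       (\<Pi>\<^sub>M t\<in>{0..}. borel) (\<lambda>x. \<lambda>t\<in>{0..}. Re (W t x))
       (\<Pi>\<^sub>M t\<in>{0..}. borel) (\<lambda>x. \<lambda>t\<in>{0..}. Im (W t x))"

text \<open>
  Equality in law of the shifted and the original path, as elements of the product space of
  functions on the time axis \<open>{0..}\<close>; this is equality of all finite-dimensional distributions.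
\<close>

definition strictly_stationary ::
    "'a measure \<Rightarrow> (real \<Rightarrow> 'a \<Rightarrow> complex) \<Rightarrow> bool" where
  "strictly_stationary M Y \<longleftrightarrow>
     (\<forall>h\<ge>0. distr M (\<Pi>\<^sub>M t\<in>{0..}. borel) (\<lambda>x. \<lambda>t\<in>{0..}. Y (t + h) x) =
             distr M (\<Pi>\<^sub>M t\<in>{0..}. borel) (\<lambda>x. \<lambda>t\<in>{0..}. Y t x))"

text \<open>
  The equation \<open>dY(t) = -(lam - i \<omega>) Y(t) dt + \<sigma> dW(t)\<close>. The diffusion coefficient is constant, so
  its integrated form contains only a pathwise integral of \<open>Y\<close>. The initial value is independent
  of the driving complex Brownian motion; it is written as a path over the time set \<open>{0}\<close>
  because \<open>indep_var\<close> requires both variables to take values in the same type.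
\<close>

definition complex_OU_solution ::
    "'a measure \<Rightarrow> real \<Rightarrow> real \<Rightarrow> real \<Rightarrow> (real \<Rightarrow> 'a \<Rightarrow> complex) \<Rightarrow>
      (real \<Rightarrow> 'a \<Rightarrow> complex) \<Rightarrow> bool" where
  "complex_OU_solution M lam \<omega> \<sigma> W Y \<longleftrightarrow>
     (\<forall>t\<ge>0. Y t \<in> borel_measurable M) \<and>
     prob_space.indep_var M
       (\<Pi>\<^sub>M t\<in>{0}. borel) (\<lambda>x. \<lambda>t\<in>{0}. Y t x)
       (\<Pi>\<^sub>M t\<in>{0..}. borel) (\<lambda>x. \<lambda>t\<in>{0..}. W t x) \<and>
     (AE x in M. continuous_on {0..} (\<lambda>t. Y t x) \<and>
        (\<forall>t\<ge>0. Y t x = Y 0 x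
            - (complex_of_real lam - \<i> * complex_of_real \<omega>) * integral {0..t} (\<lambda>s. Y s x)
            + complex_of_real \<sigma> * W t x))"

definition normalized_stationary_complex_OU ::
    "'a measure \<Rightarrow> real \<Rightarrow> real \<Rightarrow> (real \<Rightarrow> 'a \<Rightarrow> complex) \<Rightarrow> bool" where
  "normalized_stationary_complex_OU M lam \<omega> Y \<longleftrightarrow>
     (\<exists>\<sigma> W. \<sigma> > 0 \<and> \<sigma>\<^sup>2 / (2 * lam) = 1 \<and>
        complex_brownian_motion M W \<and>
        complex_OU_solution M lam \<omega> \<sigma> W Y \<and>
        strictly_stationary M Y)"

subsection \<open>Designs and covariance matrices of the observations\<close>

text \<open>The design points are \<open>t 1, \<dots>, t n\<close>; other values of \<open>t\<close> are irrelevant.\<close>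

definition admissible_design :: "nat \<Rightarrow> (nat \<Rightarrow> real) \<Rightarrow> bool" where
  "admissible_design n t \<longleftrightarrow> 0 \<le> t 1 \<and> (\<forall>j\<in>{1..<n}. t j < t (j + 1))"

definition design_gap :: "(nat \<Rightarrow> real) \<Rightarrow> nat \<Rightarrow> real" where
  "design_gap t j = t (j + 1) - t j"

definition covariance :: "'a measure \<Rightarrow> ('a \<Rightarrow> real) \<Rightarrow> ('a \<Rightarrow> real) \<Rightarrow> real" where
  "covariance M X Y = (\<integral>x. (X x - (\<integral>y. X y \<partial>M)) * (Y x - (\<integral>y. Y y \<partial>M)) \<partial>M)"

text \<open>
  Matrix indices start at 0, so that \<open>obs Z t 0, obs Z t 1, \<dots>, obs Z t (2 n - 1)\<close> are
  \<open>Z\<^sub>1(t 1), Z\<^sub>2(t 1), \<dots>, Z\<^sub>1(t n), Z\<^sub>2(t n)\<close>, where \<open>Z = Z\<^sub>1 + i Z\<^sub>2\<close>.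
\<close>

definition obs :: "(real \<Rightarrow> 'a \<Rightarrow> complex) \<Rightarrow> (nat \<Rightarrow> real) \<Rightarrow> nat \<Rightarrow> 'a \<Rightarrow> real" where
  "obs Z t i x = (let z = Z (t (i div 2 + 1)) x in if even i then Re z else Im z)"

definition obs_cov ::
    "'a measure \<Rightarrow> (real \<Rightarrow> 'a \<Rightarrow> complex) \<Rightarrow> nat \<Rightarrow> (nat \<Rightarrow> real) \<Rightarrow> real mat" where
  "obs_cov M Z n t = mat (2 * n) (2 * n) (\<lambda>(i, j). covariance M (obs Z t i) (obs Z t j))"

subsection \<open>Fisher information\<close>

definition mat_tr :: "real mat \<Rightarrow> real" where
  "mat_tr A = (\<Sum>i<dim_row A. A $$ (i, i))"

definition mat_deriv :: "(real \<Rightarrow> real mat) \<Rightarrow> real \<Rightarrow> real mat" where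
  "mat_deriv A x = mat (dim_row (A x)) (dim_col (A x)) (\<lambda>(i, j). deriv (\<lambda>y. A y $$ (i, j)) x)"

definition fisher_entry :: "real mat \<Rightarrow> real mat \<Rightarrow> real mat \<Rightarrow> real" where
  "fisher_entry C D E = 1/2 * mat_tr (the (mat_inverse C) * D * the (mat_inverse C) * E)"

text \<open>
  \<open>C\<close> is the covariance matrix as a function of \<open>(lam, \<omega>)\<close>.
\<close>

definition fisher_damping :: "(real \<Rightarrow> real \<Rightarrow> real mat) \<Rightarrow> real \<Rightarrow> real \<Rightarrow> real" where
  "fisher_damping C lam \<omega> =
     fisher_entry (C lam \<omega>) (mat_deriv (\<lambda>l. C l \<omega>) lam) (mat_deriv (\<lambda>l. C l \<omega>) lam)"

definition fisher_frequency :: "(real \<Rightarrow> real \<Rightarrow> real mat) \<Rightarrow> real \<Rightarrow> real \<Rightarrow> real" where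
  "fisher_frequency C lam \<omega> =
     fisher_entry (C lam \<omega>) (mat_deriv (\<lambda>w. C lam w) \<omega>) (mat_deriv (\<lambda>w. C lam w) \<omega>)"

definition fisher_mixed :: "(real \<Rightarrow> real \<Rightarrow> real mat) \<Rightarrow> real \<Rightarrow> real \<Rightarrow> real" where
  "fisher_mixed C lam \<omega> =
     fisher_entry (C lam \<omega>) (mat_deriv (\<lambda>l. C l \<omega>) lam) (mat_deriv (\<lambda>w. C lam w) \<omega>)"

definition fisher_matrix :: "(real \<Rightarrow> real \<Rightarrow> real mat) \<Rightarrow> real \<Rightarrow> real \<Rightarrow> real mat" where
  "fisher_matrix C lam \<omega> = mat_of_rows_list 2
     [[fisher_damping C lam \<omega>, fisher_mixed C lam \<omega>],
      [fisher_mixed C lam \<omega>, fisher_frequency C lam \<omega>]]"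

subsection \<open>Optimal designs and the Lambert function\<close>

definition D_optimal_design :: "nat \<Rightarrow> ((nat \<Rightarrow> real) \<Rightarrow> real) \<Rightarrow> (nat \<Rightarrow> real) \<Rightarrow> bool" where
  "D_optimal_design n crit t \<longleftrightarrow> is_arg_max crit (admissible_design n) t"

text \<open>The principal branch; meaningful for arguments \<open>\<ge> -exp (-1)\<close>.\<close>

definition Lambert_W :: "real \<Rightarrow> real" where
  "Lambert_W = inv_into {-1..} (\<lambda>w. w * exp w)"

end

theory Submission
  imports Defs
begin

text \<open>
  Variation of constants writes \<open>Y t - exp (- (lam - i \<omega>) t) Y 0\<close> as a pathwise limit of weighted sums
  of Brownian increments, hence as a Gaussian variable independent of \<open>Y 0\<close>. Stationarity and
  \<open>t \<rightarrow> \<infinity>\<close> then force \<open>Y 0\<close> to be Gaussian, which yields the covariances.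

  Rotating the \<open>p\<close>-th observation by the angle \<open>- \<omega> t p\<close> reduces the covariance matrix to that of a
  real Ornstein--Uhlenbeck process, a Markov process. Passing to its one-step innovations diagonalises
  it, and the Fisher traces telescope to sums over the gaps: \<open>I_lam = \<Sum>j. A (d j)\<close>,
  \<open>I_omega = \<Sum>j. B (d j)\<close>, with vanishing mixed term. Halving a gap always increases \<open>A\<close>, whereas \<open>B\<close>
  has a unique maximum. For the determinant, let \<open>d0\<close> be the zero of the logarithmic derivative of
  \<open>A B\<close>; it also uniquely maximises \<open>A / A d0 + B / B d0\<close>, so that the product of the two sums is
  bounded through the arithmetic-geometric mean inequality.
\<close>

section \<open>Gaussian law of the innovations\<close>

text \<open>The noise coefficient is constant, so the equation is read path by path without a
  stochastic integral. Characteristic functions turn the passage to the limit into dominated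
  convergence, and only squared moduli of the weights survive in them; hence the frequency
  disappears from the law of the innovation.

  The phase of a covariance entry is a difference \<open>w * (u p - u q)\<close>, so rotations
  depending on one time each can remove it, and a frequency derivative only brings in the factor
  \<i> and the time difference.

  The determinant criterion is a product of two sums, and maximising \<open>A B\<close> gap by gap
  says nothing about mixed products of \<open>A\<close> at one gap and \<open>B\<close> at another.
  The sum \<open>A / A d0 + B / B d0\<close> is additive over gaps, and its derivative at
  \<open>d0\<close> is the logarithmic derivative of \<open>A B\<close> there. That this critical
  point is a global maximum is a separate fact, obtained by counting sign changes through repeated
  differentiation.\<close>

lemma langevin_Riemann_sum:
  fixes y w :: "real \<Rightarrow> complex" and a \<sigma> :: complex
  assumes cont: "continuous_on {0..} y"
    and eq: "\<And>t. 0 \<le> t \<Longrightarrow> y t = y 0 - a * integral {0..t} y + \<sigma> * w t"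
    and a: "0 \<le> Re a" and T: "0 < T"
  defines "s \<equiv> \<lambda>k j. T * real j / real (Suc k)"
  shows "(\<lambda>k. \<Sum>j<Suc k. exp (- a * complex_of_real (T - s k j)) * (\<sigma> * (w (s k (Suc j)) - w (s k j))))
    \<longlonglongrightarrow> y T - exp (- a * complex_of_real T) * y 0"
    (is "?S \<longlonglongrightarrow> ?N")
proof (rule LIMSEQ_I)
  have contT: "continuous_on {0..T} y" using cont by (rule continuous_on_subset) auto
  have "compact (y ` {0..T})" using contT by (rule compact_continuous_image) simp
  then obtain B where B: "\<And>t. t \<in> {0..T} \<Longrightarrow> norm (y t) \<le> B"
    by (meson bounded_iff compact_imp_bounded imageI)
  have B0: "0 \<le> B" using B[of 0] T norm_ge_zero[of "y 0"] by (simp add: order_trans[OF norm_ge_zero])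
  \<comment> \<open>There are \<open>Suc k\<close> steps of length \<open>h = T / Suc k\<close>,
    each with error at most \<open>(B + norm a) * \<epsilon> * h\<close>.\<close>
  define C where "C = T * (B + norm a)"
  have C0: "0 \<le> C" using B0 T by (simp add: C_def)
  fix e :: real assume e: "0 < e"
  define \<epsilon> where "\<epsilon> = e / (C + 1)"
  have \<epsilon>: "0 < \<epsilon>" "C * \<epsilon> < e" using e C0 by (simp_all add: \<epsilon>_def divide_simps) 
  obtain \<delta> where \<delta>: "0 < \<delta>" "\<And>t t'. t \<in> {0..T} \<Longrightarrow> t' \<in> {0..T} \<Longrightarrow> dist t' t < \<delta> \<Longrightarrow> dist (y t') (y t) < \<epsilon>"
    
    using compact_uniformly_continuous[OF contT compact_Icc, unfolded uniformly_continuous_on_def, rule_format, OF \<epsilon>(1)]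
    by blast
  have h0: "(\<lambda>k. T / real (Suc k)) \<longlonglongrightarrow> 0"
    using LIMSEQ_Suc[OF lim_const_over_n[of T]] by simp
  have "((\<lambda>h. exp (a * h)) has_field_derivative a) (at 0)"
    by (auto intro!: derivative_eq_intros)
  then have "((\<lambda>h. (exp (a * h) - 1) / h - a) \<longlongrightarrow> 0) (at 0)"
    by (simp add: DERIV_def LIM_zero_iff)
  moreover have "filterlim (\<lambda>k. complex_of_real (T / real (Suc k))) (at 0) sequentially"
    using T tendsto_of_real[OF h0, where 'a=complex] by (intro filterlim_atI always_eventually) (auto simp del: of_nat_Suc)
  ultimately have "(\<lambda>k. (exp (a * complex_of_real (T / real (Suc k))) - 1) / complex_of_real (T / real (Suc k)) - a) \<longlonglongrightarrow> 0"
    by (rule filterlim_compose)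
  then have "\<forall>\<^sub>F k in sequentially. norm ((exp (a * complex_of_real (T / real (Suc k))) - 1) / complex_of_real (T / real (Suc k)) - a) < \<epsilon>"
    using \<epsilon>(1) by (auto dest: tendstoD simp: dist_norm)
  moreover have "\<forall>\<^sub>F k in sequentially. T / real (Suc k) < \<delta>"
    using h0 \<delta>(1) by (rule order_tendstoD)
  ultimately have "\<forall>\<^sub>F k in sequentially. norm (?S k - ?N) < e"
  proof eventually_elim
    case (elim k)
    define h where "h = T / real (Suc k)"
    define E where "E = (\<lambda>j. exp (- a * complex_of_real (T - s k j)))"
    have h: "0 < h" "h < \<delta>" using T elim by (simp_all add: h_def)
    have sS: "s k (Suc j) = s k j + h" for j by (simp add: s_def h_def add_divide_distrib algebra_simps)
    have s0: "s k 0 = 0" "s k (Suc k) = T" by (simp_all add: s_def)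
    have s_range: "0 \<le> s k j" "s k j \<le> T" if "j \<le> Suc k" for j
      using that T by (simp_all add: s_def divide_le_eq mult_left_mono)
    have ES: "E (Suc j) = E j * exp (a * complex_of_real h)" for j
      by (simp add: E_def sS algebra_simps flip: exp_add)
    have exp_h: "norm (exp (a * complex_of_real h) - 1 - a * h) \<le> \<epsilon> * h"
    proof -
      have "exp (a * complex_of_real h) - 1 - a * h = ((exp (a * complex_of_real h) - 1) / h - a) * h"
        using h by (simp add: field_simps)
      also have "norm \<dots> \<le> \<epsilon> * h"
        unfolding norm_mult
      proof (rule mult_mono)
        show "norm ((exp (a * complex_of_real h) - 1) / h - a) \<le> \<epsilon>"
          unfolding h_def using elim(1) by (rule less_imp_le)
      qed (use h \<epsilon> in simp_all)
      finally show ?thesis .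
    qed
    \<comment> \<open>One summand of the telescoping sum for \<open>E j * y (s k j)\<close>. The
      integral equation replaces the increment of \<open>w\<close> by one of \<open>y\<close>, so no
      variation bound on \<open>w\<close> enters. There remain the error of linearising
      \<open>exp (a * h)\<close> and that of freezing \<open>y\<close> at the right end point under
      the integral.\<close>
    have step: "norm (E (Suc j) * y (s k (Suc j)) - E j * y (s k j) - E j * (\<sigma> * (w (s k (Suc j)) - w (s k j)))) 
      \<le> (B + norm a) * \<epsilon> * h" if j: "j < Suc k" for j
    proof -
      let ?p = "s k j" and ?q = "s k (Suc j)"
      have pq: "0 \<le> ?p" "?p \<le> ?q" "?q \<le> T" "?q - ?p = h" using s_range[of j] s_range(2)[of "Suc j"] j sS[of j] h by simp_all
      have cpq: "continuous_on {?p..?q} y" using contT by (rule continuous_on_subset) (use pq in auto)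
      have comb: "integral {0..?p} y + integral {?p..?q} y = integral {0..?q} y"
        using pq by (intro Henstock_Kurzweil_Integration.integral_combine integrable_continuous_real
            continuous_on_subset[OF contT]) auto
      have eqs: "y ?p = y 0 - a * integral {0..?p} y + \<sigma> * w ?p" "y ?q = y 0 - a * integral {0..?q} y + \<sigma> * w ?q"
        using pq by (intro eq; linarith)+
      have alg: "\<sigma> * (wq - wp) = yq - yp + a * I"
        if "Ip + I = Iq" "yp = y0 - a * Ip + \<sigma> * wp" "yq = y0 - a * Iq + \<sigma> * wq" for Ip Iq I yp yq y0 wp wq
        unfolding that(2,3) that(1)[symmetric] by (simp add: algebra_simps)
      have key: "\<sigma> * (w ?q - w ?p) = y ?q - y ?p + a * integral {?p..?q} y"
        by (rule alg[OF comb eqs])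
      have "E (Suc j) * y ?q - E j * y ?p - E j * (\<sigma> * (w ?q - w ?p)) =
        E j * ((exp (a * h) - 1 - a * h) * y ?q + a * (h * y ?q - integral {?p..?q} y))"
        unfolding key ES by (simp add: algebra_simps)
      also have "h * y ?q - integral {?p..?q} y = integral {?p..?q} (\<lambda>r. y ?q - y r)"
      proof -
        have "integral {?p..?q} (\<lambda>r. y ?q - y r) = integral {?p..?q} (\<lambda>r. y ?q) - integral {?p..?q} y"
          by (intro Henstock_Kurzweil_Integration.integral_diff integrable_continuous_real cpq) auto
        then show ?thesis using pq by (simp add: scaleR_conv_of_real)
      qed
      also have "norm (E j * ((exp (a * h) - 1 - a * h) * y ?q + a * integral {?p..?q} (\<lambda>r. y ?q - y r)))
        \<le> 1 * (\<epsilon> * h * B + norm a * (\<epsilon> * h))"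
        unfolding norm_mult
      proof (rule mult_mono)
        have "0 \<le> Re a * (T - ?p)" using a pq by (intro mult_nonneg_nonneg) auto
        then show "norm (E j) \<le> 1" by (simp add: E_def)
        have "norm (integral {?p..?q} (\<lambda>r. y ?q - y r)) \<le> \<epsilon> * (?q - ?p)"
        proof (rule integral_bound)
          fix r assume r: "r \<in> {?p..?q}"
          then have "dist ?q r < \<delta>" using pq h by (auto simp: dist_real_def)
          then show "norm (y ?q - y r) \<le> \<epsilon>"
            using \<delta>(2)[of r ?q] r pq by (auto simp: dist_norm)
        qed (use pq cpq in \<open>auto intro!: continuous_intros\<close>)
        then have "norm (a * integral {?p..?q} (\<lambda>r. y ?q - y r)) \<le> norm a * (\<epsilon> * h)"
          unfolding norm_mult pq(4) by (rule mult_left_mono) simp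
        moreover have "norm ((exp (a * h) - 1 - a * h) * y ?q) \<le> \<epsilon> * h * B"
          unfolding norm_mult using B[of ?q] pq \<epsilon> h by (intro mult_mono[OF exp_h]) auto
        ultimately show "norm ((exp (a * h) - 1 - a * h) * y ?q + a * integral {?p..?q} (\<lambda>r. y ?q - y r))
           \<le> \<epsilon> * h * B + norm a * (\<epsilon> * h)"
          by (intro norm_triangle_mono)
      qed auto
      finally show ?thesis by (simp add: algebra_simps)
    qed
    have "?N = E (Suc k) * y (s k (Suc k)) - E 0 * y (s k 0)"
      unfolding s0 by (simp add: E_def s0)
    also have "\<dots> = (\<Sum>j<Suc k. E (Suc j) * y (s k (Suc j)) - E j * y (s k j))"
      by (subst sum_lessThan_telescope) simp
    finally have "?N - ?S k = (\<Sum>j<Suc k. E (Suc j) * y (s k (Suc j)) - E j * y (s k j)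
       - E j * (\<sigma> * (w (s k (Suc j)) - w (s k j))))"
      by (simp only: sum_subtractf E_def)
    also have "norm \<dots> \<le> real (card {..<Suc k}) * ((B + norm a) * \<epsilon> * h)"
      by (rule order_trans[OF norm_sum sum_bounded_above]) (rule step, simp)
    also have "\<dots> = C * \<epsilon>" by (simp add: C_def h_def)
    also have "\<dots> < e" by fact
    finally show ?case by (simp add: norm_minus_commute)
  qed
  then show "\<exists>N. \<forall>k\<ge>N. norm (?S k - ?N) < e" by (rule eventually_sequentially[THEN iffD1])
qed

text \<open>This is the previous lemma for the driving path \<open>w t = t\<close>.\<close>

lemma exp_Riemann_sum:
  assumes c: "0 < c" and T: "0 < T"
  shows "(\<lambda>k. \<Sum>j<Suc k. exp (- c * (T - T * real j / real (Suc k))) * (T / real (Suc k)))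
    \<longlonglongrightarrow> (1 - exp (- c * T)) / c"
proof -
  \<comment> \<open>The solution of \<open>y' = 1 - c * y\<close> with \<open>y 0 = 0\<close>.
    Solving the equation for \<open>y\<close> also supplies the antiderivative
    \<open>(t - y t) / c\<close> used below.\<close>
  define y where "y = (\<lambda>t::real. complex_of_real ((1 - exp (- c * t)) / c))"
  have eqy: "y t = y 0 - complex_of_real c * integral {0..t} y + 1 * complex_of_real t" if "0 \<le> t" for t
  proof -
    have "((\<lambda>t. (t - (1 - exp (- c * t)) / c) / c) has_real_derivative (1 - exp (- c * x)) / c) (at x)" for x
      using c by (auto intro!: derivative_eq_intros)
    then have "((\<lambda>t. complex_of_real ((t - (1 - exp (- c * t)) / c) / c)) has_vector_derivative y x) (at x within {0..t})" for x
      unfolding y_def by (intro has_vector_derivative_of_real has_vector_derivative_at_within)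
        (simp add: has_real_derivative_iff_has_vector_derivative)
    then have "(y has_integral (complex_of_real ((t - (1 - exp (- c * t)) / c) / c) - complex_of_real ((0 - (1 - exp (- c * 0)) / c) / c))) {0..t}"
      using that by (intro fundamental_theorem_of_calculus) auto
    then have "integral {0..t} y = complex_of_real ((t - (1 - exp (- c * t)) / c) / c)"
      by (simp add: integral_unique)
    then show ?thesis using c by (simp add: y_def)
  qed
  have conty: "continuous_on {0..} y" unfolding y_def by (intro continuous_intros) (use c in auto)
  have "(\<lambda>k. \<Sum>j<Suc k. exp (- complex_of_real c * complex_of_real (T - T * real j / real (Suc k))) *
      (1 * (complex_of_real (T * real (Suc j) / real (Suc k)) - complex_of_real (T * real j / real (Suc k)))))
    \<longlonglongrightarrow> y T - exp (- complex_of_real c * complex_of_real T) * y 0"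
    by (rule langevin_Riemann_sum[OF conty eqy _ T]) (use c in simp_all)
  moreover have "exp (- complex_of_real c * complex_of_real (T - T * real j / real (Suc k))) *
      (1 * (complex_of_real (T * real (Suc j) / real (Suc k)) - complex_of_real (T * real j / real (Suc k))))
    = complex_of_real (exp (- c * (T - T * real j / real (Suc k))) * (T / real (Suc k)))" for j k
  proof -
    have "T * real (Suc j) - T * real j = T" by (simp add: algebra_simps)
    then have "T * real (Suc j) / real (Suc k) - T * real j / real (Suc k) = T / real (Suc k)"
      by (simp only: diff_divide_distrib[symmetric])
    then show ?thesis by (simp only: exp_of_real[symmetric] of_real_mult of_real_minus of_real_diff[symmetric] mult_1)
  qed
  ultimately have "(\<lambda>k. complex_of_real (\<Sum>j<Suc k. exp (- c * (T - T * real j / real (Suc k))) * (T / real (Suc k))))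
    \<longlonglongrightarrow> complex_of_real ((1 - exp (- c * T)) / c)"
    by (simp only: of_real_sum) (simp add: y_def)
  then show ?thesis by (simp only: tendsto_of_real_iff)
qed


section \<open>Characteristic functions of weighted Brownian increments\<close>

lemma (in prob_space) normal_char:
  assumes X: "distributed M lborel X (\<lambda>u. ennreal (normal_density 0 \<sigma> u))" and \<sigma>: "0 < \<sigma>"
  shows "(CLINT x|M. iexp (a * X x)) = complex_of_real (exp (- (a * \<sigma>)\<^sup>2 / 2))"
proof -
  have d: "distributed M lborel (\<lambda>x. X x / \<sigma>) (\<lambda>u. ennreal (std_normal_density u))"
    using X normal_standard_normal_convert[OF \<sigma>, of X 0] by simp
  have "complex_of_real (exp (- (a * \<sigma>)\<^sup>2 / 2)) = char std_normal_distribution (a * \<sigma>)"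
    by (simp add: char_std_normal_distribution)
  also have "std_normal_distribution = distr M lborel (\<lambda>x. X x / \<sigma>)"
    using distributed_distr_eq_density[OF d] by simp
  also have "char (distr M lborel (\<lambda>x. X x / \<sigma>)) (a * \<sigma>) = (CLINT x|M. iexp (a * \<sigma> * (X x / \<sigma>)))"
    unfolding char_def using distributed_measurable[OF d] by (subst integral_distr) auto
  also have "\<dots> = (CLINT x|M. iexp (a * X x))" using \<sigma> by simp
  finally show ?thesis by simp
qed

lemma standard_BM_char_sum:
  assumes bm: "standard_brownian_motion M W" and s: "0 \<le> s 0" "\<And>i. s i < s (Suc i)"
  shows "(CLINT x|M. iexp (\<Sum>j<k. \<alpha> j * (W (s (Suc j)) x - W (s j) x))) =
    complex_of_real (exp (- (\<Sum>j<k. (\<alpha> j)\<^sup>2 * (s (Suc j) - s j)) / 2))"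
proof -
  interpret prob_space M using bm by (simp add: standard_brownian_motion_def)
  have s0: "0 \<le> s j" for j by (induction j) (use s in \<open>auto intro: order_trans less_imp_le\<close>)
  let ?D = "\<lambda>j x. W (s (Suc j)) x - W (s j) x"
  have "indep_vars (\<lambda>_. borel) ?D {..<k}"
    using bm s unfolding standard_brownian_motion_def by blast
  then have indep: "indep_vars (\<lambda>_. borel) (\<lambda>j x. \<alpha> j * ?D j x) {..<k}"
    by (rule indep_vars_compose2) auto
  have [measurable]: "W (s j) \<in> borel_measurable M" for j
    using bm s0 by (simp add: standard_brownian_motion_def)
  have meas: "(\<lambda>x. \<alpha> j * ?D j x) \<in> borel_measurable M" for j
    by measurable
  have "(CLINT x|M. iexp (\<Sum>j<k. \<alpha> j * ?D j x)) = char (distr M borel (\<lambda>x. \<Sum>j<k. \<alpha> j * ?D j x)) 1"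
    unfolding char_def using meas by (subst integral_distr) auto
  also have "\<dots> = (\<Prod>j<k. char (distr M borel (\<lambda>x. \<alpha> j * ?D j x)) 1)"
    by (rule char_distr_sum[OF indep])
  also have "\<dots> = (\<Prod>j<k. complex_of_real (exp (- ((\<alpha> j)\<^sup>2 * (s (Suc j) - s j)) / 2)))"
  proof (rule prod.cong[OF refl])
    fix j
    have "char (distr M borel (\<lambda>x. \<alpha> j * ?D j x)) 1 = (CLINT x|M. iexp (\<alpha> j * ?D j x))"
      unfolding char_def using meas by (subst integral_distr) auto
    also have "\<dots> = complex_of_real (exp (- (\<alpha> j * sqrt (s (Suc j) - s j))\<^sup>2 / 2))"
      using bm s s0 unfolding standard_brownian_motion_def by (intro normal_char) auto
    also have "(\<alpha> j * sqrt (s (Suc j) - s j))\<^sup>2 = (\<alpha> j)\<^sup>2 * (s (Suc j) - s j)"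
      using s(2)[of j] by (simp add: power_mult_distrib)
    finally show "char (distr M borel (\<lambda>x. \<alpha> j * ?D j x)) 1 =
      complex_of_real (exp (- ((\<alpha> j)\<^sup>2 * (s (Suc j) - s j)) / 2))" .
  qed
  also have "\<dots> = complex_of_real (exp (\<Sum>j<k. - ((\<alpha> j)\<^sup>2 * (s (Suc j) - s j)) / 2))"
    by (simp add: exp_sum)
  also have "(\<Sum>j<k. - ((\<alpha> j)\<^sup>2 * (s (Suc j) - s j)) / 2) = - (\<Sum>j<k. (\<alpha> j)\<^sup>2 * (s (Suc j) - s j)) / 2"
    by (simp only: sum_divide_distrib[symmetric] sum_negf)
  finally show ?thesis .
qed

lemma (in prob_space) indep_var_iexp_add:
  fixes F G :: "'b \<Rightarrow> real"
  assumes ind: "indep_var N1 X N2 Y" and F: "F \<in> borel_measurable N1" and G: "G \<in> borel_measurable N2"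
  shows "(CLINT x|M. iexp (F (X x) + G (Y x))) = (CLINT x|M. iexp (F (X x))) * (CLINT x|M. iexp (G (Y x)))"
proof -
  have m: "X \<in> measurable M N1" "Y \<in> measurable M N2"
    using indep_var_rv1[OF ind] indep_var_rv2[OF ind] by auto
  have m2: "(\<lambda>x. F (X x)) \<in> borel_measurable M" "(\<lambda>x. G (Y x)) \<in> borel_measurable M"
    using m F G by measurable
  have "indep_var borel ((\<lambda>y. iexp (F y)) \<circ> X) borel ((\<lambda>y. iexp (G y)) \<circ> Y)"
    by (rule indep_var_compose[OF ind]) (use F G in measurable)
  then have "indep_var borel (\<lambda>x. iexp (F (X x))) borel (\<lambda>x. iexp (G (Y x)))"
    by (simp add: comp_def)
  then have "(CLINT x|M. iexp (F (X x)) * iexp (G (Y x))) = (CLINT x|M. iexp (F (X x))) * (CLINT x|M. iexp (G (Y x)))"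
    by (rule indep_var_lebesgue_integral) (use m2 in \<open>auto intro!: integrable_iexp\<close>)
  then show ?thesis by (simp add: distrib_left exp_add)
qed

text \<open>The real part of \<open>c\<close> times an increment is \<open>Re c\<close> times its
  real part minus \<open>Im c\<close> times its imaginary part. The two paths are independent, so
  the variances add up to the squared modulus and the argument of \<open>c\<close> is lost.\<close>

lemma complex_BM_char_sum:
  assumes bm: "complex_brownian_motion M W" and s: "0 \<le> s 0" "\<And>i. s i < s (Suc i)"
  shows "(CLINT x|M. iexp (Re (\<Sum>j<k. c j * (W (s (Suc j)) x - W (s j) x)))) =
    complex_of_real (exp (- (\<Sum>j<k. (cmod (c j))\<^sup>2 * (s (Suc j) - s j)) / 2))"
proof -
  have bmR: "standard_brownian_motion M (\<lambda>t x. Re (W t x))" and bmI: "standard_brownian_motion M (\<lambda>t x. Im (W t x))"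
    using bm by (auto simp: complex_brownian_motion_def)
  interpret prob_space M using bmR by (simp add: standard_brownian_motion_def)
  have s0: "0 \<le> s j" for j by (induction j) (use s in \<open>auto intro: order_trans less_imp_le\<close>)
  let ?F = "\<lambda>f. \<Sum>j<k. Re (c j) * (f (s (Suc j)) - f (s j))"
  let ?G = "\<lambda>f. \<Sum>j<k. - Im (c j) * (f (s (Suc j)) - f (s j))"
  let ?P = "\<Pi>\<^sub>M t\<in>{0::real..}. (borel :: real measure)"
  have [measurable]: "(\<lambda>f. f (s j)) \<in> borel_measurable ?P" for j
    using s0[of j] by (intro measurable_component_singleton) simp
  have "(CLINT x|M. iexp (?F (\<lambda>t\<in>{0..}. Re (W t x)) + ?G (\<lambda>t\<in>{0..}. Im (W t x)))) =
    (CLINT x|M. iexp (?F (\<lambda>t\<in>{0..}. Re (W t x)))) * (CLINT x|M. iexp (?G (\<lambda>t\<in>{0..}. Im (W t x))))"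
  proof (rule indep_var_iexp_add[where F = ?F and G = ?G and X = "\<lambda>x. \<lambda>t\<in>{0..}. Re (W t x)"
        and Y = "\<lambda>x. \<lambda>t\<in>{0..}. Im (W t x)"])
    show "indep_var ?P (\<lambda>x. \<lambda>t\<in>{0..}. Re (W t x)) ?P (\<lambda>x. \<lambda>t\<in>{0..}. Im (W t x))"
      using bm by (simp add: complex_brownian_motion_def)
  qed measurable
  also have "(CLINT x|M. iexp (?F (\<lambda>t\<in>{0..}. Re (W t x)) + ?G (\<lambda>t\<in>{0..}. Im (W t x)))) =
    (CLINT x|M. iexp (Re (\<Sum>j<k. c j * (W (s (Suc j)) x - W (s j) x))))"
    using s0 by (simp add: sum.distrib[symmetric] algebra_simps)
  also have "(CLINT x|M. iexp (?F (\<lambda>t\<in>{0..}. Re (W t x)))) =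
    (CLINT x|M. iexp (\<Sum>j<k. Re (c j) * (Re (W (s (Suc j)) x) - Re (W (s j) x))))"
    using s0 by simp
  also have "(CLINT x|M. iexp (?G (\<lambda>t\<in>{0..}. Im (W t x)))) =
    (CLINT x|M. iexp (\<Sum>j<k. - Im (c j) * (Im (W (s (Suc j)) x) - Im (W (s j) x))))"
    using s0 by simp
  finally show ?thesis
    unfolding standard_BM_char_sum[OF bmR s] standard_BM_char_sum[OF bmI s]
    by (simp add: cmod_power2 distrib_right sum.distrib add_divide_distrib exp_add[symmetric] flip: of_real_mult)
qed

text \<open>The innovation over \<open>[0, T]\<close> is the pathwise limit of sums
  \<open>S k\<close> that depend on the driving path alone, so each of them is independent of
  \<open>Y 0\<close>. The factorisation survives the limit because the integrands have modulus
  1.\<close>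

lemma OU_char_limit:
  assumes bm: "complex_brownian_motion M W" and sol: "complex_OU_solution M lam \<omega> \<sigma> W Y"
    and lam: "0 < lam" and \<sigma>: "\<sigma>\<^sup>2 = 2 * lam" and T: "0 < T"
  defines "a \<equiv> complex_of_real lam - \<i> * complex_of_real \<omega>"
  shows "(CLINT x|M. iexp (Re (\<eta> * Y 0 x) + Re (\<zeta> * (Y T x - exp (- a * T) * Y 0 x)))) =
    (CLINT x|M. iexp (Re (\<eta> * Y 0 x))) * complex_of_real (exp (- ((cmod \<zeta>)\<^sup>2 * (1 - exp (- 2 * lam * T))) / 2))"
proof -
  interpret prob_space M
    using bm by (simp add: complex_brownian_motion_def standard_brownian_motion_def)
  define s where "s = (\<lambda>k j. T * real j / real (Suc k))"
  have s: "0 \<le> s k 0" "s k j < s k (Suc j)" "0 \<le> s k j" for k j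
    using T by (simp_all add: s_def divide_strict_right_mono)
  have step: "s k (Suc j) - s k j = T / real (Suc k)" for k j
  proof -
    have "T * real (Suc j) - T * real j = T" by (simp add: algebra_simps)
    then show ?thesis by (simp only: s_def diff_divide_distrib[symmetric])
  qed
  define c where "c = (\<lambda>k j. exp (- a * complex_of_real (T - s k j)) * complex_of_real \<sigma>)"
  define S where "S = (\<lambda>k f. \<Sum>j<Suc k. c k j * (f (s k (Suc j)) - f (s k j)) :: complex)"
  have Ymeas [measurable]: "Y t \<in> borel_measurable M" if "0 \<le> t" for t
    using sol that by (simp add: complex_OU_solution_def)
  have Wmeas [measurable]: "W t \<in> borel_measurable M" if "0 \<le> t" for t
    using bm that unfolding complex_brownian_motion_def standard_brownian_motion_def
    by (subst borel_measurable_complex_iff) auto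
  let ?P = "\<Pi>\<^sub>M t\<in>{0::real..}. (borel :: complex measure)"
  let ?Q = "\<Pi>\<^sub>M t\<in>{0::real}. (borel :: complex measure)"
  have [measurable]: "(\<lambda>f. f (s k j)) \<in> borel_measurable ?P" for k j
    using s(3)[of k j] by (intro measurable_component_singleton) simp
  have [measurable]: "(\<lambda>f. f 0) \<in> borel_measurable ?Q"
    by (intro measurable_component_singleton) simp
  have indep: "indep_var ?Q (\<lambda>x. \<lambda>t\<in>{0}. Y t x) ?P (\<lambda>x. \<lambda>t\<in>{0..}. W t x)"
    using sol by (simp add: complex_OU_solution_def)
  \<comment> \<open>Independence is assumed for paths restricted to \<open>{0..}\<close>; all
    sampling times lie there.\<close>
  have S_restrict: "S k (\<lambda>t\<in>{0..}. W t x) = S k (\<lambda>t. W t x)" for k x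
    using s(3) by (simp add: S_def)
  have approx: "(CLINT x|M. iexp (Re (\<eta> * Y 0 x) + Re (\<zeta> * S k (\<lambda>t. W t x)))) =
    (CLINT x|M. iexp (Re (\<eta> * Y 0 x))) * complex_of_real (exp (- ((cmod \<zeta>)\<^sup>2 * \<sigma>\<^sup>2 *
      (\<Sum>j<Suc k. exp (- (2 * lam) * (T - T * real j / real (Suc k))) * (T / real (Suc k)))) / 2))" for k
  proof -
    have "(CLINT x|M. iexp (Re (\<eta> * (\<lambda>t\<in>{0}. Y t x) 0) + Re (\<zeta> * S k (\<lambda>t\<in>{0..}. W t x)))) =
      (CLINT x|M. iexp (Re (\<eta> * (\<lambda>t\<in>{0}. Y t x) 0))) * (CLINT x|M. iexp (Re (\<zeta> * S k (\<lambda>t\<in>{0..}. W t x))))"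
    proof (rule indep_var_iexp_add[OF indep, where F = "\<lambda>f. Re (\<eta> * f 0)" and G = "\<lambda>f. Re (\<zeta> * S k f)"])
    qed (unfold S_def, measurable)
    also have "(CLINT x|M. iexp (Re (\<zeta> * S k (\<lambda>t\<in>{0..}. W t x)))) =
      (CLINT x|M. iexp (Re (\<Sum>j<Suc k. (\<zeta> * c k j) * (W (s k (Suc j)) x - W (s k j) x))))"
      unfolding S_restrict by (simp only: S_def sum_distrib_left mult.assoc)
    also have "\<dots> = complex_of_real (exp (- (\<Sum>j<Suc k. (cmod (\<zeta> * c k j))\<^sup>2 * (s k (Suc j) - s k j)) / 2))"
      by (rule complex_BM_char_sum[OF bm]) (use s in auto)
    \<comment> \<open>The frequency only turns the weights, so their moduli leave a real Riemann
      sum. Multiplied by \<open>\<sigma>\<^sup>2 = 2 * lam\<close>, its limit is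
      \<open>1 - exp (- 2 * lam * T)\<close>.\<close>
    also have "(\<Sum>j<Suc k. (cmod (\<zeta> * c k j))\<^sup>2 * (s k (Suc j) - s k j)) =
      (\<Sum>j<Suc k. (cmod \<zeta>)\<^sup>2 * \<sigma>\<^sup>2 * (exp (- (2 * lam) * (T - T * real j / real (Suc k))) * (T / real (Suc k))))"
    proof (rule sum.cong[OF refl])
      fix j
      have "cmod (c k j) = exp (- lam * (T - s k j)) * \<bar>\<sigma>\<bar>"
        by (simp add: c_def norm_mult a_def)
      then have "(cmod (c k j))\<^sup>2 = exp (- (2 * lam) * (T - s k j)) * \<sigma>\<^sup>2"
        by (simp add: power_mult_distrib flip: exp_double)
      then show "(cmod (\<zeta> * c k j))\<^sup>2 * (s k (Suc j) - s k j) = (cmod \<zeta>)\<^sup>2 * \<sigma>\<^sup>2 *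
        (exp (- (2 * lam) * (T - T * real j / real (Suc k))) * (T / real (Suc k)))"
        unfolding step norm_mult power_mult_distrib by (simp only: s_def mult_ac)
    qed
    finally show ?thesis unfolding S_restrict sum_distrib_left by simp
  qed
  have "(\<lambda>k. CLINT x|M. iexp (Re (\<eta> * Y 0 x) + Re (\<zeta> * S k (\<lambda>t. W t x)))) \<longlonglongrightarrow>
    (CLINT x|M. iexp (Re (\<eta> * Y 0 x) + Re (\<zeta> * (Y T x - exp (- a * T) * Y 0 x))))"
  proof (rule integral_dominated_convergence[where w="\<lambda>_. 1"])
    have "AE x in M. continuous_on {0..} (\<lambda>t. Y t x) \<and>
        (\<forall>t\<ge>0. Y t x = Y 0 x - a * integral {0..t} (\<lambda>s. Y s x) + complex_of_real \<sigma> * W t x)"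
      using sol by (simp add: complex_OU_solution_def a_def)
    then show "AE x in M. (\<lambda>k. iexp (Re (\<eta> * Y 0 x) + Re (\<zeta> * S k (\<lambda>t. W t x)))) \<longlonglongrightarrow>
      iexp (Re (\<eta> * Y 0 x) + Re (\<zeta> * (Y T x - exp (- a * T) * Y 0 x)))"
    proof eventually_elim
      case (elim x)
      then have path: "continuous_on {0..} (\<lambda>t. Y t x)"
        "\<And>t. 0 \<le> t \<Longrightarrow> Y t x = Y 0 x - a * integral {0..t} (\<lambda>s. Y s x) + complex_of_real \<sigma> * W t x"
        by blast+
      have "0 \<le> Re a" using lam by (simp add: a_def)
      note lim = langevin_Riemann_sum[where y="\<lambda>t. Y t x" and w="\<lambda>t. W t x", OF path this T]
      have "(\<lambda>k. \<Sum>j<Suc k. exp (- a * complex_of_real (T - T * real j / real (Suc k))) *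
        (complex_of_real \<sigma> * (W (T * real (Suc j) / real (Suc k)) x - W (T * real j / real (Suc k)) x)))
        \<longlonglongrightarrow> Y T x - exp (- a * complex_of_real T) * Y 0 x"
        by (rule lim)
      then have "(\<lambda>k. S k (\<lambda>t. W t x)) \<longlonglongrightarrow> Y T x - exp (- a * complex_of_real T) * Y 0 x"
        by (simp only: S_def c_def s_def mult.assoc)
      then show ?case by (intro tendsto_intros)
    qed
  qed (use T s in \<open>auto simp: S_def\<close>)
  moreover have "(\<lambda>k. CLINT x|M. iexp (Re (\<eta> * Y 0 x) + Re (\<zeta> * S k (\<lambda>t. W t x)))) \<longlonglongrightarrow>
    (CLINT x|M. iexp (Re (\<eta> * Y 0 x))) * complex_of_real (exp (- ((cmod \<zeta>)\<^sup>2 * \<sigma>\<^sup>2 * ((1 - exp (- (2 * lam) * T)) / (2 * lam))) / 2))"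
    unfolding approx using exp_Riemann_sum[of "2 * lam" T] lam T
    by (intro tendsto_intros) auto
  ultimately show ?thesis using lam
    by (simp add: LIMSEQ_unique \<sigma>)
qed


section \<open>Real matrices with complex blocks\<close>

text \<open>
  A complex entry stands for the real \<open>2 \<times> 2\<close> block of multiplication by it, so that products and
  traces can be computed with complex \<open>n \<times> n\<close> entries.
\<close>

definition rotation_block_mat :: "nat \<Rightarrow> (nat \<Rightarrow> nat \<Rightarrow> complex) \<Rightarrow> real mat" where
  "rotation_block_mat n F = mat (2 * n) (2 * n) (\<lambda>(i, j). let z = F (i div 2) (j div 2) in
     if even i \<longleftrightarrow> even j then Re z else if even i then - Im z else Im z)"

lemma rotation_block_mat_carrier [simp]: "rotation_block_mat n F \<in> carrier_mat (2 * n) (2 * n)"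
  by (simp add: rotation_block_mat_def)

lemma dim_rotation_block_mat [simp]:
  "dim_row (rotation_block_mat n F) = 2 * n" "dim_col (rotation_block_mat n F) = 2 * n"
  by (simp_all add: rotation_block_mat_def)

lemma rotation_block_mat_cong:
  "(\<And>p q. p < n \<Longrightarrow> q < n \<Longrightarrow> F p q = G p q) \<Longrightarrow> rotation_block_mat n F = rotation_block_mat n G"
  by (auto simp: rotation_block_mat_def less_mult_imp_div_less mult.commute[of 2] intro!: cong_mat)

lemma sum_lessThan_double:
  fixes f :: "nat \<Rightarrow> 'b::comm_monoid_add"
  shows "(\<Sum>i<2 * n. f i) = (\<Sum>p<n. f (2 * p) + f (2 * p + 1))"
  by (induction n) (auto simp: ac_simps)

lemma rotation_block_mat_mult:
  "rotation_block_mat n F * rotation_block_mat n G = rotation_block_mat n (\<lambda>p q. \<Sum>r<n. F p r * G r q)"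
proof (rule eq_matI)
  fix i j
  assume "i < dim_row (rotation_block_mat n (\<lambda>p q. \<Sum>r<n. F p r * G r q))"
    and "j < dim_col (rotation_block_mat n (\<lambda>p q. \<Sum>r<n. F p r * G r q))"
  then have ij: "i < 2 * n" "j < 2 * n" by simp_all
  have "(rotation_block_mat n F * rotation_block_mat n G) $$ (i, j) =
    (\<Sum>k<2 * n. rotation_block_mat n F $$ (i, k) * rotation_block_mat n G $$ (k, j))"
    using ij by (simp add: scalar_prod_def lessThan_atLeast0)
  also have "\<dots> = rotation_block_mat n (\<lambda>p q. \<Sum>r<n. F p r * G r q) $$ (i, j)"
    unfolding sum_lessThan_double using ij
    by (auto simp: rotation_block_mat_def Let_def sum_negf[symmetric] simp del: sum_negf intro!: sum.cong)
  finally show "(rotation_block_mat n F * rotation_block_mat n G) $$ (i, j) =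
    rotation_block_mat n (\<lambda>p q. \<Sum>r<n. F p r * G r q) $$ (i, j)" .
qed auto

lemma rotation_block_mat_one:
  assumes "\<And>p q. p < n \<Longrightarrow> q < n \<Longrightarrow> F p q = (if p = q then 1 else 0)"
  shows "rotation_block_mat n F = 1\<^sub>m (2 * n)"
proof -
  have "rotation_block_mat n F = rotation_block_mat n (\<lambda>p q. if p = q then 1 else 0)"
    using assms by (rule rotation_block_mat_cong)
  also have "\<dots> = 1\<^sub>m (2 * n)"
    by (rule eq_matI) (auto simp: rotation_block_mat_def, presburger+)
  finally show ?thesis .
qed

lemma mat_tr_rotation_block_mat: "mat_tr (rotation_block_mat n F) = 2 * Re (\<Sum>p<n. F p p)"
  by (auto simp: mat_tr_def sum_lessThan_double rotation_block_mat_def sum_distrib_left intro!: sum.cong)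

section \<open>Traces, inverses and derivatives of block matrices\<close>

lemma mat_tr_mult_commute:
  assumes "A \<in> carrier_mat n n" "B \<in> carrier_mat n n"
  shows "mat_tr (A * B) = mat_tr (B * A)"
proof -
  have "mat_tr (A * B) = (\<Sum>i<n. \<Sum>k<n. A $$ (i, k) * B $$ (k, i))"
    using assms by (auto simp: mat_tr_def scalar_prod_def lessThan_atLeast0 intro!: sum.cong)
  also have "\<dots> = (\<Sum>k<n. \<Sum>i<n. B $$ (k, i) * A $$ (i, k))"
    by (subst sum.swap) (simp add: mult.commute)
  also have "\<dots> = mat_tr (B * A)"
    using assms by (auto simp: mat_tr_def scalar_prod_def lessThan_atLeast0 intro!: sum.cong)
  finally show ?thesis .
qed

text \<open>A one-sided inverse of a square matrix over a field is two-sided. This excludes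
  \<open>None\<close> and forces the computed inverse to be \<open>B\<close>, so that an inverse
  exhibited by hand can be used in \<open>fisher_entry\<close>.\<close>

lemma mat_inverse_eq_Some:
  fixes A :: "'b::field mat"
  assumes A: "A \<in> carrier_mat n n" and B: "B \<in> carrier_mat n n" and AB: "A * B = 1\<^sub>m n"
  shows "mat_inverse A = Some B"
proof (cases "mat_inverse A")
  case None
  have BA: "B * A = 1\<^sub>m n" using mat_mult_left_right_inverse[OF A B AB] .
  have "A \<in> Units (ring_mat TYPE('b) n undefined)"
    using A B AB BA by (auto simp: Units_def ring_mat_def)
  then show ?thesis using mat_inverse(1)[OF A None, where b=undefined] by blast
next
  case (Some G)
  then have G: "G * A = 1\<^sub>m n" "G \<in> carrier_mat n n" using mat_inverse(2)[OF A Some] by auto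
  have "G = G * (A * B)" using G by (simp add: AB)
  also have "\<dots> = (G * A) * B" using assoc_mult_mat[OF G(2) A B] by simp
  also have "\<dots> = B" using G B by simp
  finally show ?thesis using Some by simp
qed

definition sandwich ::
  "nat \<Rightarrow> (nat \<Rightarrow> nat \<Rightarrow> complex) \<Rightarrow> (nat \<Rightarrow> nat \<Rightarrow> complex) \<Rightarrow> (nat \<Rightarrow> nat \<Rightarrow> complex) \<Rightarrow> nat \<Rightarrow> nat \<Rightarrow> complex"
  where "sandwich n S T F p q = (\<Sum>r<n. \<Sum>s<n. S p r * F r s * T s q)"

lemma rotation_block_mat_sandwich:
  "rotation_block_mat n S * rotation_block_mat n F * rotation_block_mat n T = rotation_block_mat n (sandwich n S T F)"
  unfolding rotation_block_mat_mult
  by (rule rotation_block_mat_cong) (simp add: sandwich_def sum_distrib_right, rule sum.swap)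

text \<open>If \<open>S F T = 1\<close>, then \<open>T S\<close> inverts \<open>F\<close>, and
  cyclicity turns the trace of \<open>T S G T S H\<close> into that of
  \<open>(S G T) (S H T)\<close>. The factor 1/2 of the Fisher information cancels the 2 from the
  trace of a block.\<close>

lemma fisher_entry_rotation_block_mat:
  assumes one: "\<And>p q. p < n \<Longrightarrow> q < n \<Longrightarrow> sandwich n S T F p q = (if p = q then 1 else 0)"
  shows "fisher_entry (rotation_block_mat n F) (rotation_block_mat n G) (rotation_block_mat n H) =
    Re (\<Sum>p<n. \<Sum>q<n. sandwich n S T G p q * sandwich n S T H q p)"
proof -
  let ?B = "rotation_block_mat n"
  note [simp] = assoc_mult_mat[where ?n\<^sub>1.0="2*n" and ?n\<^sub>2.0="2*n" and ?n\<^sub>3.0="2*n" and ?n\<^sub>4.0="2*n"]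
  have c [simp]: "A \<in> carrier_mat (2*n) (2*n) \<Longrightarrow> B \<in> carrier_mat (2*n) (2*n) \<Longrightarrow> A * B \<in> carrier_mat (2*n) (2*n)"
    for A B :: "real mat" by (rule mult_carrier_mat)
  have "?B S * (?B F * ?B T) = 1\<^sub>m (2 * n)"
    using rotation_block_mat_sandwich[of n S F T] rotation_block_mat_one[of n "sandwich n S T F", OF one] by simp
  then have "?B F * ?B T * ?B S = 1\<^sub>m (2 * n)"
    using mat_mult_left_right_inverse[of "?B S" "2 * n" "?B F * ?B T"] by simp
  then have "mat_inverse (?B F) = Some (?B T * ?B S)"
    by (intro mat_inverse_eq_Some[of _ "2 * n"]) auto
  then have "fisher_entry (?B F) (?B G) (?B H) = 1/2 * mat_tr (?B T * (?B S * ?B G * ?B T * (?B S * ?B H)))"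
    by (simp add: fisher_entry_def)
  also have "\<dots> = 1/2 * mat_tr ((?B S * ?B G * ?B T) * (?B S * ?B H * ?B T))"
    by (subst mat_tr_mult_commute[of _ "2 * n"]) auto
  also have "\<dots> = Re (\<Sum>p<n. \<Sum>q<n. sandwich n S T G p q * sandwich n S T H q p)"
    unfolding rotation_block_mat_sandwich
    unfolding rotation_block_mat_mult mat_tr_rotation_block_mat by simp
  finally show ?thesis .
qed

text \<open>Derivatives only see a neighbourhood of \<open>a\<close>. Equality is asked only there
  because the covariance formula is available for positive damping and nonzero frequency, not for
  all parameters.\<close>

lemma mat_deriv_rotation_block_mat:
  assumes ev: "\<forall>\<^sub>F x in nhds a. A x = rotation_block_mat n (F x)"
    and der: "\<And>p q. p < n \<Longrightarrow> q < n \<Longrightarrow> ((\<lambda>x. F x p q) has_vector_derivative F' p q) (at a)"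
  shows "mat_deriv A a = rotation_block_mat n F'"
proof -
  have Aa: "A a = rotation_block_mat n (F a)" using eventually_nhds_x_imp_x[OF ev] .
  have "deriv (\<lambda>x. A x $$ (i, j)) a = rotation_block_mat n F' $$ (i, j)" if ij: "i < 2 * n" "j < 2 * n" for i j
  proof -
    have p: "i div 2 < n" "j div 2 < n" using ij by auto
    have "((\<lambda>x. Re (F x (i div 2) (j div 2))) has_real_derivative Re (F' (i div 2) (j div 2))) (at a)"
      "((\<lambda>x. Im (F x (i div 2) (j div 2))) has_real_derivative Im (F' (i div 2) (j div 2))) (at a)"
      using der[OF p] 
      by (simp_all add: has_real_derivative_iff_has_vector_derivative
        bounded_linear.has_vector_derivative[OF bounded_linear_Re] bounded_linear.has_vector_derivative[OF bounded_linear_Im])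
    from this DERIV_minus[OF this(2)]
    have "((\<lambda>x. rotation_block_mat n (F x) $$ (i, j)) has_real_derivative rotation_block_mat n F' $$ (i, j)) (at a)"
      using ij by (auto simp: rotation_block_mat_def Let_def)
    moreover have ev: "\<forall>\<^sub>F x in nhds a. A x $$ (i, j) = rotation_block_mat n (F x) $$ (i, j)"
      using ev by eventually_elim simp
    ultimately have "((\<lambda>x. A x $$ (i, j)) has_real_derivative rotation_block_mat n F' $$ (i, j)) (at a)"
      using DERIV_cong_ev[OF refl ev refl] by simp
    then show ?thesis by (rule DERIV_imp_deriv)
  qed
  then show ?thesis unfolding mat_deriv_def Aa by (intro eq_matI) auto
qed

text \<open>Folds a square sum onto the lower triangle, where the whitened entries have closed
  forms.\<close>

lemma sum_symmetric_square:
  fixes g :: "nat \<Rightarrow> nat \<Rightarrow> real"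
  assumes "\<And>p q. g p q = g q p"
  shows "(\<Sum>p<n. \<Sum>q<n. g p q) = (\<Sum>p<n. g p p + 2 * (\<Sum>q<p. g p q))"
proof (induction n)
  case (Suc n)
  have "(\<Sum>p<n. g p n) = (\<Sum>q<n. g n q)" using assms by (intro sum.cong) auto
  with Suc show ?case by (simp add: sum.distrib)
qed simp


section \<open>Whitening the covariance matrix\<close>

text \<open>
  Here \<open>ratio p\<close> is the coefficient of the one-step prediction of the \<open>p\<close>-th observation and \<open>innov p\<close>
  the variance of its error. The innovations are normalised on the left only, which avoids square
  roots. As \<open>ratio 0 = 0\<close>, the truncated predecessor of index \<open>0\<close> never contributes.
\<close>

locale ou_times =
  fixes lam :: real and u :: "nat \<Rightarrow> real" and n :: nat
  assumes lam: "0 < lam" and u: "\<And>p. Suc p < n \<Longrightarrow> u p < u (Suc p)"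
begin

definition gap :: "nat \<Rightarrow> real" where "gap p = (if p = 0 then 0 else u p - u (p - 1))"
definition ratio :: "nat \<Rightarrow> real" where "ratio p = (if p = 0 then 0 else exp (- lam * gap p))"
definition innov :: "nat \<Rightarrow> real" where "innov p = 1 - (ratio p)\<^sup>2"
definition kern :: "nat \<Rightarrow> nat \<Rightarrow> real" where "kern p q = exp (- lam * \<bar>u p - u q\<bar>)"
definition kern_rot :: "real \<Rightarrow> (nat \<Rightarrow> nat \<Rightarrow> real) \<Rightarrow> nat \<Rightarrow> nat \<Rightarrow> complex" where
  "kern_rot w k p q = complex_of_real (k p q) * cis (w * (u p - u q))"
definition diff_weight :: "nat \<Rightarrow> nat \<Rightarrow> real" where
  "diff_weight p q = (if p = q then 1 else if Suc q = p then - ratio p else 0)"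
text \<open>The \<open>(p, q)\<close> entry of \<open>D k D^T\<close> for the bidiagonal matrix
  \<open>D\<close> with entries \<open>diff_weight\<close>: one-step prediction errors are formed in
  both indices.\<close>

definition whiten :: "(nat \<Rightarrow> nat \<Rightarrow> real) \<Rightarrow> nat \<Rightarrow> nat \<Rightarrow> real" where
  "whiten k p q = (k p q - ratio p * k (p - 1) q) - ratio q * (k p (q - 1) - ratio p * k (p - 1) (q - 1))"
definition left_weight :: "real \<Rightarrow> nat \<Rightarrow> nat \<Rightarrow> complex" where
  "left_weight w p q = complex_of_real (diff_weight p q / innov p) * cis (- w * u q)"
definition right_weight :: "real \<Rightarrow> nat \<Rightarrow> nat \<Rightarrow> complex" where
  "right_weight w q p = complex_of_real (diff_weight p q) * cis (w * u q)"

lemma u_less: "p < q \<Longrightarrow> q < n \<Longrightarrow> u p < u q"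
proof (induction q)
  case (Suc q)
  then show ?case using u[of q] by (cases "p = q") auto
qed simp

lemma gap_pos: "0 < p \<Longrightarrow> p < n \<Longrightarrow> 0 < gap p"
  using u_less[of "p - 1" p] by (simp add: gap_def)

lemma innov_pos: assumes "p < n" shows "0 < innov p"
proof (cases "p = 0")
  case False
  then have "ratio p < 1" "0 < ratio p" using gap_pos[of p] assms lam by (auto simp: ratio_def)
  then show ?thesis by (simp add: innov_def power_less_one_iff)
qed (simp add: innov_def ratio_def)

lemma sum_diff_weight:
  assumes "p < n" shows "(\<Sum>q<n. diff_weight p q * f q) = f p - ratio p * f (p - 1)"
proof -
  have "(\<Sum>q<n. diff_weight p q * f q) = (\<Sum>q<n. (if q = p then f q else 0) - (if Suc q = p then ratio p * f q else 0))"
    by (intro sum.cong) (auto simp: diff_weight_def)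
  also have "\<dots> = f p - (\<Sum>q<n. if Suc q = p then ratio p * f q else 0)"
    using assms by (simp add: sum_subtractf)
  also have "(\<Sum>q<n. if Suc q = p then ratio p * f q else 0) = ratio p * f (p - 1)"
  proof (cases p)
    case (Suc p')
    then show ?thesis using assms by simp
  qed (simp add: ratio_def)
  finally show ?thesis .
qed

text \<open>The phases \<open>- w * u r\<close>, \<open>w * (u r - u s)\<close> and
  \<open>w * u s\<close> add up to zero, so only the real kernel is left to be whitened. The scalar
  \<open>z\<close> makes room for the factor \<i> of a frequency derivative.\<close>

lemma sandwich_kern_rot:
  assumes "p < n" "q < n"
  shows "sandwich n (left_weight w) (right_weight w) (\<lambda>r s. z * kern_rot w k r s) p q =
    z * complex_of_real (whiten k p q / innov p)"
proof -
  have "left_weight w p r * (z * kern_rot w k r s) * right_weight w s q =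
    z / innov p * complex_of_real (diff_weight q s * (diff_weight p r * k r s))" for r s
  proof -
    have "cis (- w * u r) * cis (w * (u r - u s)) * cis (w * u s) = 1"
      by (simp add: cis_mult algebra_simps)
    then have "complex_of_real (diff_weight p r) * complex_of_real (k r s) * complex_of_real (diff_weight q s) * z *
      (cis (- w * u r) * cis (w * (u r - u s)) * cis (w * u s)) = 
      complex_of_real (diff_weight p r) * complex_of_real (k r s) * complex_of_real (diff_weight q s) * z" by simp
    then show ?thesis
      unfolding left_weight_def right_weight_def kern_rot_def by (simp add: mult_ac)
  qed
  then have "sandwich n (left_weight w) (right_weight w) (\<lambda>r s. z * kern_rot w k r s) p q =
    z / innov p * complex_of_real (\<Sum>r<n. \<Sum>s<n. diff_weight q s * (diff_weight p r * k r s))"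
    by (simp add: sandwich_def sum_distrib_left)
  also have "(\<Sum>r<n. \<Sum>s<n. diff_weight q s * (diff_weight p r * k r s)) =
     (\<Sum>s<n. diff_weight q s * (\<Sum>r<n. diff_weight p r * k r s))"
    by (subst sum.swap) (simp add: sum_distrib_left)
  also have "\<dots> = whiten k p q"
    by (simp add: sum_diff_weight assms whiten_def)
  finally show ?thesis by simp
qed

section \<open>Markov property of the exponential kernel and the whitened derivatives\<close>

lemma ratio_0 [simp]: "ratio 0 = 0" by (simp add: ratio_def)
lemma gap_0 [simp]: "gap 0 = 0" by (simp add: gap_def)
lemma ratio_Suc: "ratio (Suc p) = exp (- lam * (u (Suc p) - u p))" by (simp add: ratio_def gap_def)

lemma kern_commute: "kern p q = kern q p" by (simp add: kern_def abs_minus_commute)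

lemma kern_less: "q \<le> p \<Longrightarrow> p < n \<Longrightarrow> kern p q = exp (- lam * (u p - u q))"
  using u_less[of q p] by (cases "p = q") (auto simp: kern_def)

lemma ratio_mult_kern:
  assumes "q < p" "p < n" shows "ratio p * kern (p - 1) q = kern p q"
proof (cases p)
  case (Suc p')
  then show ?thesis using assms
    by (simp add: kern_less ratio_Suc flip: exp_add) (simp add: algebra_simps)
qed (use assms in simp)

lemma kern_mult_ratio:
  assumes "q \<le> p" "0 < q" "p < n" shows "kern p (q - 1) = ratio q * kern p q"
proof (cases q)
  case (Suc q')
  then show ?thesis using assms
    by (simp add: kern_less ratio_Suc flip: exp_add) (simp add: algebra_simps)
qed (use assms in simp)

lemma kern_refl [simp]: "kern p p = 1" by (simp add: kern_def)

lemma kern_pred: "p < n \<Longrightarrow> 0 < p \<Longrightarrow> kern p (p - 1) = ratio p"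
  using kern_mult_ratio[of p p] by simp

text \<open>The derivatives of the covariance kernel in damping and frequency, without the phase
  and, for the frequency, without the factor \<i>.\<close>

definition kern_lam :: "nat \<Rightarrow> nat \<Rightarrow> real" where "kern_lam p q = - \<bar>u p - u q\<bar> * kern p q"
definition kern_om :: "nat \<Rightarrow> nat \<Rightarrow> real" where "kern_om p q = (u p - u q) * kern p q"

text \<open>Below the diagonal \<open>ratio p * kern (p - 1) q\<close> equals
  \<open>kern p q\<close>, so the weights enter only through their increments in the first index. If
  these are the same constant at \<open>q\<close> and \<open>q - 1\<close>, the difference in the
  second index leaves the factor \<open>1 - (ratio q)\<^sup>2\<close>.\<close>

lemma whiten_weighted:
  assumes q: "q < p" and p: "p < n" and c: "f p q - f (p - 1) q = c"
    and c': "0 < q \<Longrightarrow> f p (q - 1) - f (p - 1) (q - 1) = c"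
  shows "whiten (\<lambda>r s. f r s * kern r s) p q = c * kern p q * innov q"
proof -
  have "whiten (\<lambda>r s. f r s * kern r s) p q =
    f p q * kern p q - f (p - 1) q * (ratio p * kern (p - 1) q)
    - ratio q * (f p (q - 1) * kern p (q - 1) - f (p - 1) (q - 1) * (ratio p * kern (p - 1) (q - 1)))"
    by (simp add: whiten_def algebra_simps)
  also have "\<dots> = (f p q - f (p - 1) q) * kern p q
    - ratio q * ((f p (q - 1) - f (p - 1) (q - 1)) * kern p (q - 1))"
    unfolding ratio_mult_kern[OF q p] using q p ratio_mult_kern[of "q - 1" p]
    by (simp only: left_diff_distrib less_imp_diff_less)
  also have "\<dots> = c * kern p q * innov q"
  proof (cases "q = 0")
    case True
    then show ?thesis using c by (simp add: innov_def)
  next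
    case False
    then have "kern p (q - 1) = ratio q * kern p q" "f p (q - 1) - f (p - 1) (q - 1) = c"
      using kern_mult_ratio q p c' by auto
    then show ?thesis using c by (simp add: innov_def algebra_simps power2_eq_square)
  qed
  finally show ?thesis .
qed

lemma whiten_less:
  assumes "q < p" "p < n"
  shows "whiten kern p q = 0"
    and "whiten kern_lam p q = - gap p * kern p q * innov q"
    and "whiten kern_om p q = gap p * kern p q * innov q"
proof -
  have less: "u r < u p" "u r \<le> u (p - 1)" if "r \<le> q" for r
  proof -
    show "u r < u p" using u_less that assms by simp
    show "u r \<le> u (p - 1)" 
    proof (cases "r = p - 1")
      case False
      then have "r < p - 1" using that assms by linarith
      then have "u r < u (p - 1)" using assms by (intro u_less) simp_all
      then show ?thesis by simp
    qed simp
  qed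
  have g: "u (p - 1) = u p - gap p" using assms by (simp add: gap_def)
  show "whiten kern p q = 0"
    using whiten_weighted[OF assms, of "\<lambda>_ _. 1" 0] by simp
  \<comment> \<open>Since \<open>r \<le> q \<le> p - 1\<close>, both absolute values open with the
    same sign and differ by one gap.\<close>
  have "- \<bar>u p - u r\<bar> - - \<bar>u (p - 1) - u r\<bar> = - gap p" if "r \<le> q" for r
    using less[OF that] g by simp
  then show "whiten kern_lam p q = - gap p * kern p q * innov q"
    unfolding kern_lam_def[abs_def] by (intro whiten_weighted[OF assms]) simp_all
  show "whiten kern_om p q = gap p * kern p q * innov q"
    unfolding kern_om_def[abs_def] using g by (intro whiten_weighted[OF assms]) simp_all
qed

lemma whiten_eq:
  assumes "p < n"
  shows "whiten kern p p = innov p" "whiten kern_lam p p = 2 * gap p * (ratio p)\<^sup>2" "whiten kern_om p p = 0"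
proof -
  have "whiten kern p p = innov p \<and> whiten kern_lam p p = 2 * gap p * (ratio p)\<^sup>2 \<and> whiten kern_om p p = 0"
  proof (cases "p = 0")
    case True
    then show ?thesis by (simp add: whiten_def kern_lam_def kern_om_def innov_def)
  next
    case False
    then have "kern p (p - 1) = ratio p" "kern (p - 1) p = ratio p"
      using kern_pred assms kern_commute by auto
    moreover have "u p - u (p - 1) = gap p" "\<bar>u p - u (p - 1)\<bar> = gap p" "\<bar>u (p - 1) - u p\<bar> = gap p" "u (p - 1) - u p = - gap p"
      using gap_pos[of p] False assms by (auto simp: gap_def)
    ultimately show ?thesis
      by (simp add: whiten_def kern_lam_def kern_om_def innov_def power2_eq_square algebra_simps)
  qed
  then show "whiten kern p p = innov p" "whiten kern_lam p p = 2 * gap p * (ratio p)\<^sup>2" "whiten kern_om p p = 0"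
    by auto
qed

lemma whiten_transpose: "(\<And>r s. k r s = k' s r) \<Longrightarrow> whiten k p q = whiten k' q p"
  by (simp add: whiten_def algebra_simps)

lemma whiten_uminus: "whiten (\<lambda>r s. - k r s) p q = - whiten k p q"
  by (simp add: whiten_def algebra_simps)

lemma whiten_commute:
  "whiten kern p q = whiten kern q p" "whiten kern_lam p q = whiten kern_lam q p"
  "whiten kern_om p q = - whiten kern_om q p"
proof -
  show "whiten kern p q = whiten kern q p" by (rule whiten_transpose) (rule kern_commute)
  show "whiten kern_lam p q = whiten kern_lam q p"
    by (rule whiten_transpose) (simp add: kern_lam_def kern_commute abs_minus_commute)
  show "whiten kern_om p q = - whiten kern_om q p"
    unfolding whiten_uminus[symmetric]
    by (rule whiten_transpose) (simp add: kern_om_def kern_commute[of r s for r s] algebra_simps)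
qed

text \<open>Each term is a difference of consecutive values of \<open>(kern p q)\<^sup>2\<close>, so
  the sum telescopes to \<open>(kern p (p - 1))\<^sup>2\<close>. In probabilistic terms, all earlier
  innovations together explain as much variance as the last observation alone.\<close>

lemma sum_kern_innov:
  assumes "p < n" shows "(\<Sum>q<p. (kern p q)\<^sup>2 * innov q) = (ratio p)\<^sup>2"
proof (cases p)
  case (Suc m)
  have "(\<Sum>q<Suc m. (kern p q)\<^sup>2 * innov q) = (kern p m)\<^sup>2" if "m < p" for m
    using that
  proof (induction m)
    case 0
    then show ?case by (simp add: innov_def)
  next
    case (Suc m)
    have "ratio (Suc m) * kern p (Suc m) = kern p m"
      using kern_mult_ratio[of "Suc m" p] Suc assms by simp
    then have "(kern p m)\<^sup>2 = (ratio (Suc m))\<^sup>2 * (kern p (Suc m))\<^sup>2" by (metis power_mult_distrib)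
    with Suc show ?case by (simp add: innov_def algebra_simps)
  qed
  from this[of m] show ?thesis using kern_pred[of p] Suc assms by simp
qed simp

lemma sandwich_one:
  assumes "p < n" "q < n"
  shows "sandwich n (left_weight w) (right_weight w) (kern_rot w kern) p q = (if p = q then 1 else 0)"
proof -
  have "whiten kern p q = 0" if "p \<noteq> q"
    using that whiten_less(1)[of q p] whiten_less(1)[of p q] whiten_commute(1)[of p q] assms
    by (cases "p < q") auto
  then show ?thesis
    using sandwich_kern_rot[OF assms, of w 1 kern] whiten_eq(1)[of p] innov_pos[of p] assms by auto
qed

text \<open>Used with scalars 1 for the damping and \<i> for the frequency. Then
  \<open>Re (\<i> * \<i>) = - 1\<close> cancels the minus sign that the antisymmetry of
  \<open>kern_om\<close> produces in \<open>fisher_om_sum\<close>.\<close>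

lemma fisher_kern_rot:
  "fisher_entry (rotation_block_mat n (kern_rot w kern))
     (rotation_block_mat n (\<lambda>p q. z * kern_rot w k p q)) (rotation_block_mat n (\<lambda>p q. z' * kern_rot w k' p q)) =
   Re (z * z') * (\<Sum>p<n. \<Sum>q<n. whiten k p q / innov p * (whiten k' q p / innov q))"
proof -
  have "(\<Sum>p<n. \<Sum>q<n. sandwich n (left_weight w) (right_weight w) (\<lambda>p q. z * kern_rot w k p q) p q *
      sandwich n (left_weight w) (right_weight w) (\<lambda>p q. z' * kern_rot w k' p q) q p) =
    (\<Sum>p<n. \<Sum>q<n. z * z' * complex_of_real (whiten k p q / innov p * (whiten k' q p / innov q)))"
    by (intro sum.cong refl) (simp add: sandwich_kern_rot)
  also have "\<dots> = z * z' * complex_of_real (\<Sum>p<n. \<Sum>q<n. whiten k p q / innov p * (whiten k' q p / innov q))"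
    by (simp add: sum_distrib_left)
  finally have "fisher_entry (rotation_block_mat n (kern_rot w kern))
     (rotation_block_mat n (\<lambda>p q. z * kern_rot w k p q)) (rotation_block_mat n (\<lambda>p q. z' * kern_rot w k' p q)) =
    Re (z * z' * complex_of_real (\<Sum>p<n. \<Sum>q<n. whiten k p q / innov p * (whiten k' q p / innov q)))"
    by (subst fisher_entry_rotation_block_mat[where S="left_weight w" and T="right_weight w"])
      (simp_all only: sandwich_one)
  then show ?thesis by (simp only: Re_complex_of_real Im_complex_of_real times_complex.sel mult_zero_right diff_0_right)
qed

lemma fisher_lam_sum:
  "(\<Sum>p<n. \<Sum>q<n. whiten kern_lam p q / innov p * (whiten kern_lam q p / innov q)) =
   (\<Sum>p<n. 2 * (gap p)\<^sup>2 * (ratio p)\<^sup>2 * (1 + (ratio p)\<^sup>2) / (innov p)\<^sup>2)"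
proof -
  let ?g = "\<lambda>p q. whiten kern_lam p q / innov p * (whiten kern_lam q p / innov q)"
  have "(\<Sum>p<n. \<Sum>q<n. ?g p q) = (\<Sum>p<n. ?g p p + 2 * (\<Sum>q<p. ?g p q))"
    by (rule sum_symmetric_square) (rule mult.commute)
  also have "\<dots> = (\<Sum>p<n. 2 * (gap p)\<^sup>2 * (ratio p)\<^sup>2 * (1 + (ratio p)\<^sup>2) / (innov p)\<^sup>2)"
  proof (rule sum.cong[OF refl])
    fix p assume "p \<in> {..<n}"
    then have p: "p < n" by simp
    have "(\<Sum>q<p. ?g p q) = (\<Sum>q<p. (gap p)\<^sup>2 / innov p * ((kern p q)\<^sup>2 * innov q))"
    proof (rule sum.cong[OF refl])
      fix q assume "q \<in> {..<p}"
      then have q: "q < p" by simp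
      then have "innov q > 0" using innov_pos p by simp
      then show "?g p q = (gap p)\<^sup>2 / innov p * ((kern p q)\<^sup>2 * innov q)"
        unfolding whiten_commute(2)[of q p] whiten_less(2)[OF q p] by (simp add: power2_eq_square)
    qed
    also have "\<dots> = (gap p)\<^sup>2 / innov p * (ratio p)\<^sup>2"
      unfolding sum_distrib_left[symmetric] sum_kern_innov[OF p] ..
    \<comment> \<open>Brought to the denominator of the diagonal term. With
      \<open>r = ratio p\<close> the numerators combine by
      \<open>4 * r^4 + 2 * r^2 * (1 - r^2) = 2 * r^2 * (1 + r^2)\<close>.\<close>
    also have "\<dots> = (gap p)\<^sup>2 * (ratio p)\<^sup>2 * (1 - (ratio p)\<^sup>2) / (innov p)\<^sup>2"
      using innov_pos[OF p] by (simp add: power2_eq_square) (simp add: innov_def power2_eq_square)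
    finally show "?g p p + 2 * (\<Sum>q<p. ?g p q) = 2 * (gap p)\<^sup>2 * (ratio p)\<^sup>2 * (1 + (ratio p)\<^sup>2) / (innov p)\<^sup>2"
      using innov_pos[OF p]
      by (simp add: whiten_eq(2)[OF p] divide_simps power2_eq_square) (simp add: algebra_simps)
  qed
  finally show ?thesis .
qed

lemma fisher_om_sum:
  "(\<Sum>p<n. \<Sum>q<n. whiten kern_om p q / innov p * (whiten kern_om q p / innov q)) =
   - (\<Sum>p<n. 2 * (gap p)\<^sup>2 * (ratio p)\<^sup>2 / innov p)"
proof -
  let ?g = "\<lambda>p q. whiten kern_om p q / innov p * (whiten kern_om q p / innov q)"
  have "(\<Sum>p<n. \<Sum>q<n. ?g p q) = (\<Sum>p<n. ?g p p + 2 * (\<Sum>q<p. ?g p q))"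
    by (rule sum_symmetric_square) (rule mult.commute)
  also have "\<dots> = (\<Sum>p<n. - (2 * (gap p)\<^sup>2 * (ratio p)\<^sup>2 / innov p))"
  proof (rule sum.cong[OF refl])
    fix p assume "p \<in> {..<n}"
    then have p: "p < n" by simp
    have "(\<Sum>q<p. ?g p q) = (\<Sum>q<p. - (gap p)\<^sup>2 / innov p * ((kern p q)\<^sup>2 * innov q))"
    proof (rule sum.cong[OF refl])
      fix q assume "q \<in> {..<p}"
      then have q: "q < p" by simp
      then have "innov q > 0" using innov_pos p by simp
      then show "?g p q = - (gap p)\<^sup>2 / innov p * ((kern p q)\<^sup>2 * innov q)"
        unfolding whiten_commute(3)[of q p] whiten_less(3)[OF q p] by (simp add: power2_eq_square)
    qed
    also have "\<dots> = - (gap p)\<^sup>2 / innov p * (ratio p)\<^sup>2"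
      unfolding sum_distrib_left[symmetric] sum_kern_innov[OF p] ..
    finally show "?g p p + 2 * (\<Sum>q<p. ?g p q) = - (2 * (gap p)\<^sup>2 * (ratio p)\<^sup>2 / innov p)"
      by (simp add: whiten_eq(3)[OF p])
  qed
  finally show ?thesis by (simp add: sum_negf)
qed

text \<open>A symmetric array times an antisymmetric one: exchanging the indices changes the sign of
  every term.\<close>

lemma fisher_mixed_sum:
  "(\<Sum>p<n. \<Sum>q<n. whiten kern_lam p q / innov p * (whiten kern_om q p / innov q)) = 0"
proof -
  let ?g = "\<lambda>p q. whiten kern_lam p q / innov p * (whiten kern_om q p / innov q)"
  have "(\<Sum>p<n. \<Sum>q<n. ?g p q) = (\<Sum>q<n. \<Sum>p<n. ?g p q)" by (rule sum.swap)
  also have "\<dots> = (\<Sum>q<n. \<Sum>p<n. - ?g q p)"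
  proof (rule sum.cong[OF refl], rule sum.cong[OF refl])
    show "?g p q = - ?g q p" for p q
      using whiten_commute(2)[of p q] whiten_commute(3)[of q p] by (simp add: mult.commute)
  qed
  finally show ?thesis by (simp add: sum_negf)
qed

end


section \<open>The gains of a single gap\<close>

text \<open>The score functions below are transcendental and cannot be solved for their zeros. This
  sign pattern passes to primitives that start nonnegative, so it can be checked by differentiating
  until the sign or monotonicity is evident.\<close>

definition single_crossing :: "(real \<Rightarrow> real) \<Rightarrow> bool" where
  "single_crossing f \<longleftrightarrow> (\<forall>x y. 0 < x \<longrightarrow> x < y \<longrightarrow> f x \<le> 0 \<longrightarrow> f y < 0)"

lemma single_crossingD: "single_crossing f \<Longrightarrow> 0 < x \<Longrightarrow> x < y \<Longrightarrow> f x \<le> 0 \<Longrightarrow> f y < 0"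
  by (auto simp: single_crossing_def)

lemma single_crossing_antimono:
  assumes "\<And>x y. 0 < x \<Longrightarrow> x < y \<Longrightarrow> f y < f x"
  shows "single_crossing f"
  unfolding single_crossing_def using assms by fastforce

text \<open>If \<open>f x \<le> 0\<close> although \<open>f 0 \<ge> 0\<close>, the mean value
  theorem gives a point before \<open>x\<close> with \<open>g \<le> 0\<close>. Beyond it
  \<open>g\<close> is negative, so \<open>f\<close> strictly falls after \<open>x\<close>.\<close>

lemma single_crossing_primitive:
  fixes f g :: "real \<Rightarrow> real"
  assumes g: "single_crossing g" and f0: "f 0 \<ge> 0"
    and der: "\<And>x. (f has_real_derivative g x) (at x)"
  shows "single_crossing f"
  unfolding single_crossing_def
proof (intro allI impI)
  fix x y :: real assume x: "0 < x" "x < y" "f x \<le> 0"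
  obtain u where u: "0 < u" "u < x" "f x - f 0 = (x - 0) * g u"
    using MVT2[of 0 x f g] x der by blast
  obtain v where v: "x < v" "v < y" "f y - f x = (y - x) * g v"
    using MVT2[of x y f g] x der by blast
  have "x * g u \<le> 0" using u x f0 by simp
  then have "g u \<le> 0" using x by (simp add: mult_le_0_iff)
  then have "g v < 0" using single_crossingD[OF g, of u v] u v by linarith
  then have "(y - x) * g v < 0" using x by (simp add: mult_less_0_iff)
  then show "f y < 0" using v x by linarith
qed

lemma single_crossing_sign:
  assumes f: "single_crossing f" and z: "0 < z" "f z = 0" and x: "0 < x"
  shows "f x > 0 \<longleftrightarrow> x < z" and "f x = 0 \<longleftrightarrow> x = z"
proof -
  have "f x < 0" if "z < x" using single_crossingD[OF f z(1) that] z by simp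
  moreover have "f x > 0" if "x < z" using single_crossingD[OF f x that] z by fastforce
  ultimately show "f x > 0 \<longleftrightarrow> x < z" "f x = 0 \<longleftrightarrow> x = z"
    using z by (metis less_asym linorder_neqE_linordered_idom less_irrefl)+
qed

lemma single_crossing_strict_max:
  fixes f c s :: "real \<Rightarrow> real"
  assumes s: "single_crossing s" and z: "0 < z" "s z = 0" and x: "0 < x" "x \<noteq> z"
    and der: "\<And>y. 0 < y \<Longrightarrow> (f has_real_derivative c y * s y) (at y)"
    and c: "\<And>y. 0 < y \<Longrightarrow> 0 < c y"
  shows "f x < f z"
proof (cases "x < z")
  case True
  obtain v where v: "x < v" "v < z" "f z - f x = (z - x) * (c v * s v)"
    using MVT2[of x z f "\<lambda>y. c y * s y"] True der x by auto
  have "s v > 0" using single_crossing_sign[OF s z, of v] v x by auto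
  then have "0 < (z - x) * (c v * s v)" using c[of v] v x by simp
  then show ?thesis using v by linarith
next
  case False
  then have xz: "z < x" using x by simp
  obtain v where v: "z < v" "v < x" "f x - f z = (x - z) * (c v * s v)"
    using MVT2[of z x f "\<lambda>y. c y * s y"] xz der z by auto
  have "s v < 0" using single_crossingD[OF s z(1) v(1)] z by simp
  then have "(x - z) * (c v * s v) < 0" using c[of v] v z by (simp add: mult_less_0_iff)
  then show ?thesis using v by linarith
qed

text \<open>The Lagrange remainder has the sign of \<open>(-x)^n\<close>, so the parity of the
  number of terms decides on which side the partial sum lies.\<close>

lemma exp_minus_Taylor_lower:
  fixes x :: real
  assumes "even n"
  shows "(\<Sum>m<n. (-x)^m / fact m) \<le> exp (-x)"
proof -
  obtain t where "exp (-x) = (\<Sum>m<n. (-x)^m / fact m) + exp t / fact n * (-x)^n"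
    using Maclaurin_exp_le by blast
  moreover have "0 \<le> exp t / fact n * (-x)^n"
    using assms by (intro mult_nonneg_nonneg zero_le_even_power) auto
  ultimately show ?thesis by linarith
qed

lemma exp_minus_Taylor_upper:
  fixes x :: real
  assumes "odd n" "0 \<le> x"
  shows "exp (-x) \<le> (\<Sum>m<n. (-x)^m / fact m)"
proof -
  obtain t where t: "exp (-x) = (\<Sum>m<n. (-x)^m / fact m) + exp t / fact n * (-x)^n"
    using Maclaurin_exp_le by blast
  have "(-x)^n \<le> 0" using assms by simp
  then have "exp t / fact n * (-x)^n \<le> 0" by (intro mult_nonneg_nonpos) auto
  then show ?thesis using t by linarith
qed

text \<open>
  A gap \<open>d\<close> contributes these gains at \<open>y = 2 * lam * d\<close>, divided by \<open>2 * lam\<^sup>2\<close>.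
\<close>

definition gain_omega :: "real \<Rightarrow> real" where
  "gain_omega y = y\<^sup>2 / (exp y - 1)"

definition gain_lam :: "real \<Rightarrow> real" where
  "gain_lam y = y\<^sup>2 * (exp y + 1) / (exp y - 1)\<^sup>2"

lemma gain_omega_pos: "0 < y \<Longrightarrow> 0 < gain_omega y"
  by (simp add: gain_omega_def)

lemma gain_lam_pos: "0 < y \<Longrightarrow> 0 < gain_lam y"
  by (auto simp: gain_lam_def intro!: divide_pos_pos mult_pos_pos add_pos_pos)

lemma gain_lam_halve:
  assumes "0 < y" shows "gain_lam y < gain_lam (y / 2)"
proof -
  define q where "q = exp (y/2)"
  have q: "q > 1" using assms by (simp add: q_def)
  have q2: "exp y = q\<^sup>2" by (simp add: q_def flip: exp_double)
  \<comment> \<open>The claim reduces to \<open>(q + 1)^3 > 4 * (q^2 + 1)\<close>. The difference of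
    the two sides is \<open>(q - 1) * (q^2 + 3)\<close>, expanded here in powers of
    \<open>q - 1\<close>.\<close>
  have "0 < (q - 1)^3 + 2 * (q-1)^2 + 4 * (q-1)" using q by (intro add_pos_pos) auto
  then have "0 < (q - 1) * (q ^ 2 + 3)"  by (simp add: algebra_simps power2_eq_square power3_eq_cube)
  then have *: "4 * (q\<^sup>2 + 1) < (q + 1) ^ 3"
    by (simp add: algebra_simps power2_eq_square power3_eq_cube)
  have "gain_lam y = y\<^sup>2 * (q\<^sup>2 + 1) / ((q - 1)\<^sup>2 * (q + 1)\<^sup>2)"
    unfolding gain_lam_def q2 by (simp add: power2_eq_square algebra_simps)
  also have "\<dots> = y\<^sup>2 / (q - 1)\<^sup>2 * ((q\<^sup>2 + 1) / (q + 1)\<^sup>2)" by simp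
  also have "\<dots> < y\<^sup>2 / (q - 1)\<^sup>2 * ((q + 1) / 4)"
  proof (rule mult_strict_left_mono)
    show "(q\<^sup>2 + 1) / (q + 1)\<^sup>2 < (q + 1) / 4"
      using * q by (simp add: divide_less_eq power2_eq_square power3_eq_cube)
  qed (use assms q in auto)
  also have "\<dots> = gain_lam (y / 2)"
    unfolding gain_lam_def q_def[symmetric] by (simp add: power_divide)
  finally show ?thesis .
qed

text \<open>This has the sign of the derivative of \<open>gain_omega\<close>.\<close>

definition omega_score :: "real \<Rightarrow> real" where
  "omega_score y = 2 - 2 * exp (-y) - y"

lemma single_crossing_omega_score: "single_crossing omega_score"
proof (rule single_crossing_primitive[where g="\<lambda>y. 2 * exp (-y) - 1"])
  show "single_crossing (\<lambda>y::real. 2 * exp (-y) - 1)"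
    by (rule single_crossing_antimono) simp
qed (auto simp: omega_score_def[abs_def] intro!: derivative_eq_intros)

lemma gain_omega_strict_max:
  assumes z: "0 < z" "omega_score z = 0" and x: "0 < x" "x \<noteq> z"
  shows "gain_omega x < gain_omega z"
proof (rule single_crossing_strict_max[OF single_crossing_omega_score z x])
  fix y :: real assume y: "0 < y"
  then have e: "exp y > 1" by simp
  show "(gain_omega has_real_derivative (y * exp y / (exp y - 1)\<^sup>2) * omega_score y) (at y)"
    unfolding gain_omega_def[abs_def] omega_score_def using e
    by (auto intro!: derivative_eq_intros simp: exp_minus divide_simps) (simp add: algebra_simps power2_eq_square)
  show "0 < y * exp y / (exp y - 1)\<^sup>2" using y e by simp
qed

text \<open>With \<open>W = y - 2\<close>, a zero \<open>y\<close> of the score means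
  \<open>W * exp W = - 2 * exp (- 2)\<close>. The solution \<open>W = - 2\<close> gives the trivial
  zero 0; the principal branch gives the positive one.\<close>

lemma Lambert_W_zero:
  defines "y1 \<equiv> Lambert_W (- 2 * exp (- 2)) + 2"
  shows "0 < y1" "omega_score y1 = 0" "\<bar>y1 / 2 - 0.7968\<bar> < 0.00005"
proof -
  define W where "W = Lambert_W (- 2 * exp (- 2))"
  \<comment> \<open>\<open>inv_into\<close> is meaningful only where a preimage exists. One is found
    between -1 and 0; the inequality at -1 amounts to \<open>2 \<le> exp 1\<close>.\<close>
  have "\<exists>w\<ge>-1. w \<le> 0 \<and> w * exp w = - 2 * exp (- 2::real)"
  proof (rule IVT')
    have "2 \<le> exp (1::real)" using exp_ge_add_one_self[of "1::real"] by simp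
    then have "2 * exp (-2) \<le> exp 1 * exp (- 2::real)" by simp
    also have "\<dots> = exp (-1)" by (simp flip: exp_add)
    finally show "- 1 * exp (- 1) \<le> - 2 * exp (- 2::real)" by simp
  qed (auto intro!: continuous_intros)
  then have "- 2 * exp (- 2) \<in> (\<lambda>w::real. w * exp w) ` {-1..}" by force
  from f_inv_into_f[OF this] inv_into_into[OF this]
  have W: "W * exp W = - 2 * exp (- 2)" "-1 \<le> W" by (auto simp: W_def Lambert_W_def)
  have y1: "y1 = W + 2" by (simp add: y1_def W_def)
  show pos: "0 < y1" using W y1 by simp
  have "2 * exp (-y1) = 2 * exp (-2) * exp (- W)" by (simp add: y1 flip: exp_add)
  also have "\<dots> = - (W * exp W) * exp (-W)" using W(1) by simp
  also have "\<dots> = - W * (exp W * exp (-W))" by (simp only: mult_minus_left mult.assoc)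
  also have "\<dots> = - W" by (simp flip: exp_add)
  finally show zero: "omega_score y1 = 0" by (simp add: omega_score_def y1)
  \<comment> \<open>The test points 1.5935 and 1.5937 are twice 0.79675 and 0.79685. The score is
    positive exactly when \<open>exp (-y) < (2 - y) / 2\<close>, which is where 0.20325 and 0.20315
    come from.\<close>
  have "exp (- 15935/10000) \<le> (\<Sum>m<13. (- (15935/10000))^m / fact m :: real)"
    using exp_minus_Taylor_upper[of 13 "15935/10000"] by simp
  also have "\<dots> < 20325/100000" by (simp add: lessThan_nat_numeral fact_numeral power_divide)
  finally have "omega_score (15935/10000) > 0" by (simp add: omega_score_def)
  then have 1: "15935/10000 < y1" 
    using single_crossing_sign(1)[OF single_crossing_omega_score pos zero, of "15935/10000"] by simp
  have "20315/100000 < (\<Sum>m<12. (- (15937/10000))^m / fact m :: real)"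
    by (simp add: lessThan_nat_numeral fact_numeral power_divide)
  also have "\<dots> \<le> exp (- 15937/10000)" 
    using exp_minus_Taylor_lower[of 12 "15937/10000"] by simp
  finally have "omega_score (15937/10000) < 0" by (simp add: omega_score_def)
  then have "y1 < 15937/10000"
    using single_crossing_sign[OF single_crossing_omega_score pos zero, of "15937/10000"] by (simp add: not_less)
  with 1 show "\<bar>y1 / 2 - 0.7968\<bar> < 0.00005" by (simp add: abs_if)
qed

text \<open>
  At \<open>y = 2 * d\<close> this is \<open>2 * exp y\<close> times \<open>1 - d - 2 * d * exp (- 2 * d) - exp (- 4 * d)\<close>.
\<close>

definition det_score :: "real \<Rightarrow> real" where
  "det_score y = 2 * exp y - 2 * exp (-y) - y * exp y - 2 * y"

lemma det_score_alt: "det_score y = exp y * (2 - y - 2 * y * exp (-y) - 2 * (exp (-y))\<^sup>2)"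
proof -
  have "exp y * exp (-y) = 1" by (simp flip: exp_add)
  then have *: "exp y * (2 * y * exp (-y)) = 2 * y" "exp y * (2 * (exp (-y))\<^sup>2) = 2 * exp (-y)"
    by (simp_all add: power2_eq_square)
  show ?thesis unfolding right_diff_distrib * by (simp add: det_score_def)
qed

text \<open>The second derivative \<open>- y * exp y - 2 * exp (- y)\<close> is negative for
  positive \<open>y\<close>. The first derivative starts at 1 and the function at 0, so the property
  lifts twice.\<close>

lemma single_crossing_det_score: "single_crossing det_score"
proof (rule single_crossing_primitive[where g="\<lambda>y. exp y * (1 - y) + 2 * exp (-y) - 2"])
  show "single_crossing (\<lambda>y::real. exp y * (1 - y) + 2 * exp (-y) - 2)"
  proof (rule single_crossing_primitive[where g="\<lambda>y. - y * exp y - 2 * exp (- y)"])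
    show "single_crossing (\<lambda>y::real. - y * exp y - 2 * exp (- y))"
    proof -
      have "- y * exp y - 2 * exp (- y) < 0" if "0 < y" for y :: real
      proof -
        have "0 < y * exp y" "0 < exp (-y)" using that by simp_all
        then show ?thesis by linarith
      qed
      then show ?thesis unfolding single_crossing_def by auto
    qed
  qed (auto intro!: derivative_eq_intros simp: algebra_simps)
qed (auto simp: det_score_def[abs_def] algebra_simps intro!: derivative_eq_intros)

lemma det_score_zero:
  obtains y0 where "0 < y0" "det_score y0 = 0" "\<bar>y0 / 2 - 0.4930\<bar> < 0.00005"
proof -
  let ?h = "\<lambda>y q. 2 - y - 2 * y * q - 2 * q\<^sup>2 :: real"
  \<comment> \<open>The test points are twice 0.49295 and 0.49305. The bracket \<open>?h y q\<close>
    decreases in \<open>q \<ge> 0\<close>, so an upper bound for \<open>exp (-y)\<close> shows that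
    it is positive. At the left point it is only about \<open>3 * 10^(-6)\<close>, hence the seven
    digits.\<close>
  have "exp (- 9859/10000) \<le> (\<Sum>m<15. (- (9859/10000))^m / fact m :: real)"
    using exp_minus_Taylor_upper[of 15 "9859/10000"] by simp
  also have "\<dots> < 3731037/10000000" by (simp add: lessThan_nat_numeral fact_numeral power_divide)
  finally have q: "exp (- 9859/10000) < (3731037/10000000::real)" .
  have "(exp (- 9859/10000))\<^sup>2 < (3731037/10000000::real)\<^sup>2" using q by (intro power_strict_mono) auto
  then have "?h (9859/10000) (exp (- 9859/10000)) > 0" using q by (simp add: power2_eq_square)
  then have 1: "det_score (9859/10000) > 0" by (simp add: det_score_alt)
  have "37302/100000 < (\<Sum>m<12. (- (9861/10000))^m / fact m :: real)"
    by (simp add: lessThan_nat_numeral fact_numeral power_divide)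
  also have "\<dots> \<le> exp (- 9861/10000)" 
    using exp_minus_Taylor_lower[of 12 "9861/10000"] by simp
  finally have q: "37302/100000 < exp (- 9861/10000::real)" .
  have "(37302/100000)\<^sup>2 < (exp (- 9861/10000::real))\<^sup>2" using q by (intro power_strict_mono) auto
  then have "?h (9861/10000) (exp (- 9861/10000)) < 0" using q by (simp add: power2_eq_square)
  then have 2: "det_score (9861/10000) < 0" by (simp add: det_score_alt mult_less_0_iff)
  have "continuous_on {9859/10000..9861/10000} det_score"
    by (auto simp: det_score_def[abs_def] intro!: continuous_intros)
  then obtain y0 where y0: "9859/10000 \<le> y0" "y0 \<le> 9861/10000" "det_score y0 = 0"
    using IVT2'[of det_score "9861/10000" 0 "9859/10000"] 1 2 by auto
  with 1 2 have "9859/10000 < y0" "y0 < 9861/10000"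
    by (metis less_eq_real_def less_irrefl)+
  then show thesis using that[of y0] y0 by (simp add: abs_if)
qed

text \<open>
  At the maximiser \<open>y0\<close> of the product of the two gains, the sum of the gains normalised by their
  values at \<open>y0\<close> is also maximal. By AM--GM this settles the product of sums.
\<close>

lemma normalised_gain_sum:
  assumes z: "0 < z" "det_score z = 0" and x: "0 < x" "x \<noteq> z"
  shows "gain_lam x / gain_lam z + gain_omega x / gain_omega z < 2"
proof -
  define E where "E = exp z"
  have E: "E > 1" using z by (simp add: E_def)
  \<comment> \<open>For positive arguments the normalised sum is a constant multiple of
    \<open>F\<close>, because \<open>(exp y + 1) * (E - 1) + (exp y - 1) * (E + 1) = 2 * (E * exp y
    - 1)\<close>. The derivative of \<open>F\<close> is a positive multiple of
    \<open>s\<close>.\<close>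
  define s where "s = (\<lambda>y. 2 * (E * exp y - E - 1 + exp (-y)) - y * (E * exp y + E - 2))"
  define F where "F = (\<lambda>y. y\<^sup>2 * (E * exp y - 1) / (exp y - 1)\<^sup>2)"
  have "single_crossing s"
  \<comment> \<open>Both \<open>s\<close> and its derivative vanish at 0, and the second derivative
    is strictly decreasing on positive arguments.\<close>
  proof (rule single_crossing_primitive[where g="\<lambda>y. E * exp y * (1 - y) - 2 * exp (-y) - E + 2"])
    show "single_crossing (\<lambda>y. E * exp y * (1 - y) - 2 * exp (-y) - E + 2)"
    proof (rule single_crossing_primitive[where g="\<lambda>y. 2 * exp (- y) - E * (y * exp y)"])
      have "x * exp x < y * exp y" if "0 < x" "x < y" for x y :: real
        using that by (intro mult_strict_mono) auto
      then have "E * (x * exp x) < E * (y * exp y)" if "0 < x" "x < y" for x y :: real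
        using that E by simp
      then show "single_crossing (\<lambda>y. 2 * exp (- y) - E * (y * exp y))"
        by (intro single_crossing_antimono diff_strict_mono) auto
    qed (auto intro!: derivative_eq_intros simp: algebra_simps)
  qed (auto simp: s_def intro!: derivative_eq_intros simp: algebra_simps)
  \<comment> \<open>A factor splits off: \<open>s z = (E - 1) * det_score z\<close>.\<close>
  moreover have "s z = 0"
  proof -
    have "z * (E + 2) = 2 * E - 2 * exp (-z)"
      using z(2) by (simp add: det_score_def E_def algebra_simps)
    then have "z * (E + 2) * (E - 1) = (2 * E - 2 * exp (-z)) * (E - 1)" by simp
    moreover have "E * exp (-z) = 1" by (simp add: E_def flip: exp_add)
    ultimately show ?thesis unfolding s_def E_def[symmetric] by (simp add: algebra_simps)
  qed
  ultimately have less: "F x < F z"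
  proof (rule single_crossing_strict_max[OF _ z(1) _ x, where c="\<lambda>y. y * exp y / (exp y - 1)^3"])
    fix y :: real assume y: "0 < y"
    then have e: "exp y > 1" by simp
    show "0 < y * exp y / (exp y - 1)^3" using y e by simp
    have "(F has_real_derivative
      ((2 * y * (E * exp y - 1) + y\<^sup>2 * (E * exp y)) * (exp y - 1)\<^sup>2 - 
        y\<^sup>2 * (E * exp y - 1) * (2 * (exp y - 1) * exp y)) / ((exp y - 1)\<^sup>2 * (exp y - 1)\<^sup>2)) (at y)"
      unfolding F_def using e
      by (auto intro!: derivative_eq_intros simp: power2_eq_square) (simp add: algebra_simps)
    moreover have "((2 * y * (E * exp y - 1) + y\<^sup>2 * (E * exp y)) * (exp y - 1)\<^sup>2 - 
        y\<^sup>2 * (E * exp y - 1) * (2 * (exp y - 1) * exp y)) / ((exp y - 1)\<^sup>2 * (exp y - 1)\<^sup>2)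
      = y * exp y / (exp y - 1)^3 * s y"
    proof -
      define u where "u = exp y"
      have u: "u > 1" "exp (-y) = 1/u" using e by (auto simp: u_def exp_minus divide_simps)
      have "((2 * y * (E * u - 1) + y\<^sup>2 * (E * u)) * (u - 1)\<^sup>2 - 
        y\<^sup>2 * (E * u - 1) * (2 * (u - 1) * u)) = (u - 1) * 
         (y * (2 * (E * u * u - E * u - u + 1) - y * (E * u * u + E * u - 2 * u)))"
        by (simp add: algebra_simps power2_eq_square)
      moreover have "s y = (2 * (E * u * u - E * u - u + 1) - y * (E * u * u + E * u - 2 * u)) / u"
        unfolding s_def u u_def[symmetric] using u by (simp add: divide_simps) (simp add: algebra_simps)
      moreover have "(u - 1)\<^sup>2 * (u - 1)\<^sup>2 = (u - 1) * (u - 1)^3"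
        by (simp add: power2_eq_square power3_eq_cube)
      ultimately show ?thesis unfolding u_def[symmetric] using u by simp
    qed
    ultimately show "(F has_real_derivative y * exp y / (exp y - 1)^3 * s y) (at y)" by simp
  qed
  have sum: "gain_lam y / gain_lam z + gain_omega y / gain_omega z = F y * (2 * (E - 1) / (z\<^sup>2 * (E + 1)))"
    if "0 < y" for y
  proof -
    have e: "exp y > 1" using that by simp
    have 1: "gain_lam y / gain_lam z = (y\<^sup>2 / (exp y - 1)\<^sup>2) * (exp y + 1) * (E - 1)\<^sup>2 / (z\<^sup>2 * (E + 1))"
      by (simp add: gain_lam_def E_def)
    have 2: "gain_omega y / gain_omega z = (y\<^sup>2 / (exp y - 1)\<^sup>2) * (exp y - 1) * (E - 1) / z\<^sup>2"
      using e by (simp add: gain_omega_def E_def power2_eq_square)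
    have "gain_lam y / gain_lam z + gain_omega y / gain_omega z =
       (y\<^sup>2 / (exp y - 1)\<^sup>2) * ((exp y + 1) * (E - 1) + (exp y - 1) * (E + 1)) * ((E - 1) / (z\<^sup>2 * (E + 1)))"
    proof -
      have "k * a * (E - 1)\<^sup>2 / (z\<^sup>2 * (E + 1)) + k * b * (E - 1) / z\<^sup>2
        = k * (a * (E - 1) + b * (E + 1)) * ((E - 1) / (z\<^sup>2 * (E + 1)))" for a b k :: real
        using z E by (simp add: divide_simps) (simp add: algebra_simps power2_eq_square)
      then show ?thesis unfolding 1 2 .
    qed
    also have "(exp y + 1) * (E - 1) + (exp y - 1) * (E + 1) = 2 * (E * exp y - 1)"
      by (simp add: algebra_simps)
    also have "(y\<^sup>2 / (exp y - 1)\<^sup>2) * (2 * (E * exp y - 1)) * ((E - 1) / (z\<^sup>2 * (E + 1)))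
      = F y * (2 * (E - 1) / (z\<^sup>2 * (E + 1)))"
    proof -
      have "k / d * (2 * b) * (a / c) = (k * b / d) * (2 * a / c)" for a b c d k :: real by simp
      then show ?thesis unfolding F_def .
    qed
    finally show ?thesis .
  qed
  have K: "0 < 2 * (E - 1) / (z\<^sup>2 * (E + 1))" using E z by simp
  have "gain_lam x / gain_lam z + gain_omega x / gain_omega z < gain_lam z / gain_lam z + gain_omega z / gain_omega z"
    unfolding sum[OF x(1)] sum[OF z(1)] using less K by (rule mult_strict_right_mono)
  also have "\<dots> = 2" using gain_lam_pos[OF z(1)] gain_omega_pos[OF z(1)] by simp
  finally show ?thesis .
qed


section \<open>Fisher information as a sum over the gaps\<close>

definition ou_kernel :: "real \<Rightarrow> real \<Rightarrow> (nat \<Rightarrow> real) \<Rightarrow> nat \<Rightarrow> nat \<Rightarrow> complex" where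
  "ou_kernel l w u p q = complex_of_real (exp (- l * \<bar>u p - u q\<bar>)) * cis (w * (u p - u q))"

lemma has_vector_derivative_ou_kernel:
  "((\<lambda>l. ou_kernel l w u p q) has_vector_derivative complex_of_real (- \<bar>u p - u q\<bar>) * ou_kernel l w u p q) (at l)"
  "((\<lambda>w. ou_kernel l w u p q) has_vector_derivative \<i> * (u p - u q) * ou_kernel l w u p q) (at w)"
  unfolding has_vector_derivative_complex_iff
  by (auto simp: ou_kernel_def intro!: derivative_eq_intros)

lemma gain_lam_gap:
  assumes "0 < lam" "0 < d" and r: "r = exp (- lam * d)"
  shows "2 * d\<^sup>2 * r\<^sup>2 * (1 + r\<^sup>2) / (1 - r\<^sup>2)\<^sup>2 = gain_lam (2 * lam * d) / (2 * lam\<^sup>2)"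
proof -
  define E where "E = exp (2 * lam * d)"
  have E: "1 < E" using assms by (simp add: E_def)
  have r2: "r\<^sup>2 = 1 / E"
    by (simp add: r E_def power2_eq_square flip: exp_add) (simp add: exp_minus divide_simps flip: exp_add)
  have "2 * d\<^sup>2 * r\<^sup>2 * (1 + r\<^sup>2) / (1 - r\<^sup>2)\<^sup>2 = 2 * d\<^sup>2 * (E + 1) / (E - 1)\<^sup>2"
    unfolding r2 using E by (simp add: divide_simps power2_eq_square)
  also have "\<dots> = gain_lam (2 * lam * d) / (2 * lam\<^sup>2)"
    using assms by (simp add: gain_lam_def E_def power_mult_distrib)
  finally show ?thesis .
qed

lemma gain_omega_gap:
  assumes "0 < lam" "0 < d" and r: "r = exp (- lam * d)"
  shows "2 * d\<^sup>2 * r\<^sup>2 / (1 - r\<^sup>2) = gain_omega (2 * lam * d) / (2 * lam\<^sup>2)"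
proof -
  define E where "E = exp (2 * lam * d)"
  have E: "1 < E" using assms by (simp add: E_def)
  have r2: "r\<^sup>2 = 1 / E"
    by (simp add: r E_def power2_eq_square flip: exp_add) (simp add: exp_minus divide_simps flip: exp_add)
  have "2 * d\<^sup>2 * r\<^sup>2 / (1 - r\<^sup>2) = 2 * d\<^sup>2 / (E - 1)"
    unfolding r2 using E by (simp add: divide_simps)
  also have "\<dots> = gain_omega (2 * lam * d) / (2 * lam\<^sup>2)"
    unfolding gain_omega_def E_def[symmetric] using E assms by (simp add: power_mult_distrib divide_simps)
  finally show ?thesis .
qed

context ou_times
begin

lemma sum_gap:
  assumes "f 0 = 0"
  shows "(\<Sum>p<n. f p) = (\<Sum>p\<in>{1..<n}. f p)"
  by (cases "n = 0") (use assms in \<open>auto simp: lessThan_atLeast0 sum.atLeast_Suc_lessThan\<close>)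

lemma fisher_information:
  assumes w: "w \<noteq> 0"
    and C: "\<And>l w. 0 < l \<Longrightarrow> w \<noteq> 0 \<Longrightarrow> C l w = rotation_block_mat n (ou_kernel l w u)"
  shows "fisher_damping C lam w = (\<Sum>p\<in>{1..<n}. gain_lam (2 * lam * (u p - u (p - 1)))) / (2 * lam\<^sup>2)"
    and "fisher_frequency C lam w = (\<Sum>p\<in>{1..<n}. gain_omega (2 * lam * (u p - u (p - 1)))) / (2 * lam\<^sup>2)"
    and "fisher_mixed C lam w = 0"
proof -
  let ?B = "rotation_block_mat n"
  have C0: "C lam w = ?B (kern_rot w kern)"
    using C[OF lam w] by (simp add: ou_kernel_def[abs_def] kern_rot_def[abs_def] kern_def)
  have "\<forall>\<^sub>F l in nhds lam. l \<in> {0<..}"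
    by (rule eventually_nhds_in_open) (auto simp: lam)
  then have "\<forall>\<^sub>F l in nhds lam. C l w = ?B (ou_kernel l w u)"
    by eventually_elim (use C w in auto)
  then have "mat_deriv (\<lambda>l. C l w) lam = ?B (\<lambda>p q. complex_of_real (- \<bar>u p - u q\<bar>) * ou_kernel lam w u p q)"
    by (rule mat_deriv_rotation_block_mat) (rule has_vector_derivative_ou_kernel)
  also have "(\<lambda>p q. complex_of_real (- \<bar>u p - u q\<bar>) * ou_kernel lam w u p q) = (\<lambda>p q. 1 * kern_rot w kern_lam p q)"
    by (simp add: fun_eq_iff ou_kernel_def kern_rot_def kern_lam_def kern_def)
  finally have D1: "mat_deriv (\<lambda>l. C l w) lam = ?B (\<lambda>p q. 1 * kern_rot w kern_lam p q)" .
  have "\<forall>\<^sub>F v in nhds w. v \<in> - {0}"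
    by (rule eventually_nhds_in_open) (auto simp: w)
  then have "\<forall>\<^sub>F v in nhds w. C lam v = ?B (ou_kernel lam v u)"
    by eventually_elim (use C lam in auto)
  then have "mat_deriv (\<lambda>v. C lam v) w = ?B (\<lambda>p q. \<i> * (u p - u q) * ou_kernel lam w u p q)"
    by (rule mat_deriv_rotation_block_mat) (rule has_vector_derivative_ou_kernel)
  also have "(\<lambda>p q. \<i> * (u p - u q) * ou_kernel lam w u p q) = (\<lambda>p q. \<i> * kern_rot w kern_om p q)"
    by (simp add: fun_eq_iff ou_kernel_def kern_rot_def kern_om_def kern_def)
  finally have D2: "mat_deriv (\<lambda>v. C lam v) w = ?B (\<lambda>p q. \<i> * kern_rot w kern_om p q)" .
  have gp: "gap p = u p - u (p - 1)" "ratio p = exp (- lam * gap p)" "0 < gap p" if "p \<in> {1..<n}" for p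
    using that gap_pos[of p] by (auto simp: gap_def ratio_def)
  have "fisher_damping C lam w = (\<Sum>p\<in>{1..<n}. 2 * (gap p)\<^sup>2 * (ratio p)\<^sup>2 * (1 + (ratio p)\<^sup>2) / (innov p)\<^sup>2)"
    unfolding fisher_damping_def C0 D1 fisher_kern_rot fisher_lam_sum by (subst sum_gap) simp_all
  also have "\<dots> = (\<Sum>p\<in>{1..<n}. gain_lam (2 * lam * gap p) / (2 * lam\<^sup>2))"
    unfolding innov_def by (intro sum.cong gain_lam_gap lam gp) auto
  finally show "fisher_damping C lam w = (\<Sum>p\<in>{1..<n}. gain_lam (2 * lam * (u p - u (p - 1)))) / (2 * lam\<^sup>2)"
    by (simp add: gp(1) sum_divide_distrib)
  have "fisher_frequency C lam w = (\<Sum>p\<in>{1..<n}. 2 * (gap p)\<^sup>2 * (ratio p)\<^sup>2 / innov p)"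
    unfolding fisher_frequency_def C0 D2 fisher_kern_rot fisher_om_sum by (subst sum_gap) simp_all
  also have "\<dots> = (\<Sum>p\<in>{1..<n}. gain_omega (2 * lam * gap p) / (2 * lam\<^sup>2))"
    unfolding innov_def by (intro sum.cong gain_omega_gap lam gp) auto
  finally show "fisher_frequency C lam w = (\<Sum>p\<in>{1..<n}. gain_omega (2 * lam * (u p - u (p - 1)))) / (2 * lam\<^sup>2)"
    by (simp add: gp(1) sum_divide_distrib)
  show "fisher_mixed C lam w = 0"
    unfolding fisher_mixed_def C0 D1 D2 fisher_kern_rot fisher_mixed_sum by simp
qed

end

lemma det_fisher_matrix:
  assumes "fisher_mixed C l w = 0"
  shows "det (fisher_matrix C l w) = fisher_damping C l w * fisher_frequency C l w"
proof -
  have c: "fisher_matrix C l w \<in> carrier_mat 2 2"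
    by (intro carrier_matI) (simp_all add: fisher_matrix_def mat_of_rows_list_def)
  have "det (fisher_matrix C l w) = prod_list (diag_mat (fisher_matrix C l w))"
    by (rule det_upper_triangular[OF _ c])
      (auto simp: upper_triangular_def fisher_matrix_def mat_of_rows_list_def assms less_Suc_eq numeral_2_eq_2)
  also have "\<dots> = fisher_damping C l w * fisher_frequency C l w"
    by (simp add: diag_mat_def fisher_matrix_def mat_of_rows_list_def numeral_2_eq_2)
  finally show ?thesis .
qed

section \<open>Optimisation over the gaps\<close>

text \<open>Once \<open>s\<close> attains the maximum, the optimal designs are the admissible ones
  with the same criterion value, and \<open>P\<close> describes this level set. All maximisers are
  thus determined.\<close>

lemma D_optimal_iff:
  assumes s: "admissible_design n s"
    and max: "\<And>t. admissible_design n t \<Longrightarrow> crit t \<le> crit s"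
    and eq: "\<And>t. admissible_design n t \<Longrightarrow> crit t = crit s \<Longrightarrow> P t"
    and conv: "\<And>t. admissible_design n t \<Longrightarrow> P t \<Longrightarrow> crit t = crit s"
  shows "D_optimal_design n crit t \<longleftrightarrow> admissible_design n t \<and> P t"
  unfolding D_optimal_design_def is_arg_max_def
  using assms by (metis less_le not_less order_antisym)

lemma admissible_gap_pos: "admissible_design n t \<Longrightarrow> j \<in> {1..<n} \<Longrightarrow> 0 < design_gap t j"
  by (simp add: admissible_design_def design_gap_def)

lemma admissible_design_nonneg:
  assumes "admissible_design n t" "p < n"
  shows "0 \<le> t (p + 1)"
  using assms(2)
proof (induction p)
  case (Suc p)
  then have "t (p + 1) < t (p + 1 + 1)" using assms(1) by (simp add: admissible_design_def)
  then show ?case using Suc by simp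
qed (use assms in \<open>simp add: admissible_design_def\<close>)

lemma equidistant_design:
  assumes "0 < d"
  shows "admissible_design n (\<lambda>j. real j * d)" "design_gap (\<lambda>j. real j * d) j = d"
  using assms by (auto simp: admissible_design_def design_gap_def algebra_simps)

lemma no_optimal_damping:
  assumes n: "2 \<le> n" and "0 < lam"
    and crit: "\<And>t. admissible_design n t \<Longrightarrow>
      crit t = (\<Sum>j\<in>{1..<n}. gain_lam (2 * lam * design_gap t j)) / (2 * lam\<^sup>2)"
  shows "\<nexists>t. D_optimal_design n crit t"
proof
  assume "\<exists>t. D_optimal_design n crit t"
  then obtain t where t: "admissible_design n t" "\<And>s. admissible_design n s \<Longrightarrow> \<not> crit t < crit s"
    by (auto simp: D_optimal_design_def is_arg_max_def)
  \<comment> \<open>Halving all design points keeps the first one nonnegative and halves every gap;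
    \<open>n \<ge> 2\<close> ensures that there is a gap to gain from.\<close>
  have s: "admissible_design n (\<lambda>j. t j / 2)" using t(1) by (simp add: admissible_design_def)
  have g: "design_gap (\<lambda>j. t j / 2) j = design_gap t j / 2" for j
    by (simp add: design_gap_def diff_divide_distrib)
  have "(\<Sum>j\<in>{1..<n}. gain_lam (2 * lam * design_gap t j)) <
    (\<Sum>j\<in>{1..<n}. gain_lam (2 * lam * design_gap (\<lambda>j. t j / 2) j))"
  proof (rule sum_strict_mono)
    fix j assume "j \<in> {1..<n}"
    then have "0 < 2 * lam * design_gap t j" using admissible_gap_pos[OF t(1)] assms by simp
    from gain_lam_halve[OF this]
    show "gain_lam (2 * lam * design_gap t j) < gain_lam (2 * lam * design_gap (\<lambda>j. t j / 2) j)"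
      by (simp add: g)
  qed (use n in auto)
  then have "crit t < crit (\<lambda>j. t j / 2)"
    unfolding crit[OF t(1)] crit[OF s] using assms by (simp add: divide_strict_right_mono)
  then show False using t(2)[OF s] by simp
qed

lemma sum_eq_upper_bound_imp:
  fixes f :: "'b \<Rightarrow> real"
  assumes "sum f A = of_nat (card A) * c" "finite A" "\<And>x. x \<in> A \<Longrightarrow> f x \<le> c" "x \<in> A"
  shows "f x = c"
proof -
  have "sum (\<lambda>x. c - f x) A = 0" using assms(1) by (simp add: sum_subtractf)
  then show ?thesis using assms by (simp add: sum_nonneg_eq_0_iff)
qed

lemma optimal_frequency:
  assumes lam: "0 < lam" and y: "0 < y1" "omega_score y1 = 0"
    and crit: "\<And>t. admissible_design n t \<Longrightarrow>
      crit t = (\<Sum>j\<in>{1..<n}. gain_omega (2 * lam * design_gap t j)) / (2 * lam\<^sup>2)"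
  shows "D_optimal_design n crit t \<longleftrightarrow>
    admissible_design n t \<and> (\<forall>j\<in>{1..<n}. design_gap t j = y1 / (2 * lam))"
proof (rule D_optimal_iff[where s = "\<lambda>j. real j * (y1 / (2 * lam))"
    and P = "\<lambda>t. \<forall>j\<in>{1..<n}. design_gap t j = y1 / (2 * lam)"])
  let ?t0 = "\<lambda>j. real j * (y1 / (2 * lam))"
  let ?S = "\<lambda>t. \<Sum>j\<in>{1..<n}. gain_omega (2 * lam * design_gap t j)"
  have d: "0 < y1 / (2 * lam)" using lam y by simp
  show adm: "admissible_design n ?t0" using d by (rule equidistant_design)
  have S0: "?S ?t0 = of_nat (card {1..<n}) * gain_omega y1"
    unfolding equidistant_design(2)[OF d] using lam by simp
  have le: "gain_omega (2 * lam * design_gap t j) \<le> gain_omega y1"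
    and eq: "gain_omega (2 * lam * design_gap t j) = gain_omega y1 \<Longrightarrow> design_gap t j = y1 / (2 * lam)"
    if "admissible_design n t" "j \<in> {1..<n}" for t j
  proof -
    have pos: "0 < 2 * lam * design_gap t j" using admissible_gap_pos[OF that] lam by simp
    note max = gain_omega_strict_max[OF y pos]
    show "gain_omega (2 * lam * design_gap t j) \<le> gain_omega y1" using max by fastforce
    show "design_gap t j = y1 / (2 * lam)" if "gain_omega (2 * lam * design_gap t j) = gain_omega y1"
      using max that lam by (auto simp: field_simps)
  qed
  have crit_iff: "crit s \<le> crit ?t0 \<longleftrightarrow> ?S s \<le> ?S ?t0" "crit s = crit ?t0 \<longleftrightarrow> ?S s = ?S ?t0"
    if "admissible_design n s" for s
    unfolding crit[OF that] crit[OF adm] using lam by (simp_all add: divide_le_cancel)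
  fix t assume t: "admissible_design n t"
  show "crit t \<le> crit ?t0"
    unfolding crit_iff(1)[OF t] S0 using le[OF t] by (intro sum_bounded_above) auto
  show "\<forall>j\<in>{1..<n}. design_gap t j = y1 / (2 * lam)" if "crit t = crit ?t0"
  proof
    fix j assume j: "j \<in> {1..<n}"
    have "?S t = of_nat (card {1..<n}) * gain_omega y1"
      using that unfolding crit_iff(2)[OF t] S0 .
    then have "gain_omega (2 * lam * design_gap t j) = gain_omega y1"
      by (rule sum_eq_upper_bound_imp[OF _ finite_atLeastLessThan _ j]) (rule le[OF t])
    then show "design_gap t j = y1 / (2 * lam)" by (rule eq[OF t j])
  qed
  show "crit t = crit ?t0" if "\<forall>j\<in>{1..<n}. design_gap t j = y1 / (2 * lam)"
    unfolding crit_iff(2)[OF t] S0 using that lam by simp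
qed

lemma optimal_det:
  assumes n: "2 \<le> n" and lam: "0 < lam" and y: "0 < y0" "det_score y0 = 0"
    and crit: "\<And>t. admissible_design n t \<Longrightarrow>
      crit t = (\<Sum>j\<in>{1..<n}. gain_lam (2 * lam * design_gap t j)) / (2 * lam\<^sup>2) *
        ((\<Sum>j\<in>{1..<n}. gain_omega (2 * lam * design_gap t j)) / (2 * lam\<^sup>2))"
  shows "D_optimal_design n crit t \<longleftrightarrow>
    admissible_design n t \<and> (\<forall>j\<in>{1..<n}. design_gap t j = y0 / (2 * lam))"
proof (rule D_optimal_iff[where s = "\<lambda>j. real j * (y0 / (2 * lam))"
    and P = "\<lambda>t. \<forall>j\<in>{1..<n}. design_gap t j = y0 / (2 * lam)"])
  let ?t0 = "\<lambda>j. real j * (y0 / (2 * lam))"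
  let ?A = "\<lambda>t. (\<Sum>j\<in>{1..<n}. gain_lam (2 * lam * design_gap t j) / gain_lam y0)"
  let ?B = "\<lambda>t. (\<Sum>j\<in>{1..<n}. gain_omega (2 * lam * design_gap t j) / gain_omega y0)"
  define N where "N = real (card {1..<n})"
  have N: "0 < N" using n by (simp add: N_def)
  have pos: "0 < gain_lam y0" "0 < gain_omega y0" using y gain_lam_pos gain_omega_pos by auto
  have d: "0 < y0 / (2 * lam)" using lam y by simp
  show adm: "admissible_design n ?t0" using d by (rule equidistant_design)
  have A0: "?A ?t0 = N" and B0: "?B ?t0 = N"
    unfolding equidistant_design(2)[OF d] using lam pos by (simp_all add: N_def)
  have le: "gain_lam (2 * lam * design_gap t j) / gain_lam y0 + gain_omega (2 * lam * design_gap t j) / gain_omega y0 \<le> 2"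
    and eq: "gain_lam (2 * lam * design_gap t j) / gain_lam y0 + gain_omega (2 * lam * design_gap t j) / gain_omega y0 = 2
      \<Longrightarrow> design_gap t j = y0 / (2 * lam)"
    if "admissible_design n t" "j \<in> {1..<n}" for t j
  proof -
    have posg: "0 < 2 * lam * design_gap t j" using admissible_gap_pos[OF that] lam by simp
    note max = normalised_gain_sum[OF y posg]
    show "gain_lam (2 * lam * design_gap t j) / gain_lam y0 + gain_omega (2 * lam * design_gap t j) / gain_omega y0 \<le> 2"
      using max pos by fastforce
    show "design_gap t j = y0 / (2 * lam)" if "gain_lam (2 * lam * design_gap t j) / gain_lam y0 + gain_omega (2 * lam * design_gap t j) / gain_omega y0 = 2"
      using max that lam by (auto simp: field_simps)
  qed
  \<comment> \<open>The constant split off by normalising both gains at \<open>y0\<close>.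
    Afterwards the two sums agree at the equidistant design, the equality case of the mean
    inequality.\<close>
  define K where "K = gain_lam y0 * gain_omega y0 / (2 * lam\<^sup>2)\<^sup>2"
  have K: "0 < K" using pos lam by (simp add: K_def)
  have critK: "crit s = ?A s * ?B s * K" if "admissible_design n s" for s
    unfolding crit[OF that] K_def sum_divide_distrib[symmetric] using pos
    by (simp add: power2_eq_square)
  have sum_le: "?A s + ?B s \<le> N * 2" if "admissible_design n s" for s
    unfolding sum.distrib[symmetric] N_def using le[OF that] by (intro sum_bounded_above) auto
  have nonneg: "0 \<le> ?A s" "0 \<le> ?B s" if "admissible_design n s" for s
  proof -
    have "0 < gain_lam (2 * lam * design_gap s j)" "0 < gain_omega (2 * lam * design_gap s j)"
      if "j \<in> {1..<n}" for j
      using admissible_gap_pos[OF \<open>admissible_design n s\<close> that] lam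
      by (simp_all add: gain_lam_pos gain_omega_pos)
    then show "0 \<le> ?A s" "0 \<le> ?B s"
      using pos by (auto intro!: sum_nonneg divide_nonneg_nonneg dest: less_imp_le simp: less_imp_le)
  qed
  have amgm: "4 * (a * b) = (a + b)\<^sup>2 - (a - b)\<^sup>2" for a b :: real
    by (simp add: power2_eq_square algebra_simps)
  have sq: "(?A s + ?B s)\<^sup>2 \<le> (N * 2)\<^sup>2" if "admissible_design n s" for s
    using sum_le[OF that] nonneg[OF that] by (intro power_mono) auto
  fix t assume t: "admissible_design n t"
  have "4 * (?A t * ?B t) \<le> (N * 2)\<^sup>2"
    unfolding amgm using sq[OF t] zero_le_power2[of "?A t - ?B t"] by linarith
  then have "?A t * ?B t \<le> N * N" by (simp add: power2_eq_square)
  then show "crit t \<le> crit ?t0"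
    unfolding critK[OF t] critK[OF adm] A0 B0 using K by (simp add: mult_right_mono)
  show "\<forall>j\<in>{1..<n}. design_gap t j = y0 / (2 * lam)" if "crit t = crit ?t0"
  proof
    fix j assume j: "j \<in> {1..<n}"
    have "?A t * ?B t = N * N" using that K unfolding critK[OF t] critK[OF adm] A0 B0 by simp
    \<comment> \<open>Equality is traced back: \<open>?A t + ?B t\<close> cannot lie below
      \<open>N * 2\<close>, so every gap attains its bound 2, which only the gap belonging to
      \<open>y0\<close> does.\<close>
    then have "(N * 2)\<^sup>2 \<le> (?A t + ?B t)\<^sup>2"
      using amgm[of "?A t" "?B t"] zero_le_power2[of "?A t - ?B t"] by (simp add: power2_eq_square)
    then have "N * 2 \<le> ?A t + ?B t"
      by (rule power2_le_imp_le) (use nonneg[OF t] in simp)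
    with sum_le[OF t] have "?A t + ?B t = N * 2" by simp
    then have "gain_lam (2 * lam * design_gap t j) / gain_lam y0 + gain_omega (2 * lam * design_gap t j) / gain_omega y0 = 2"
      unfolding sum.distrib[symmetric] N_def
      by (rule sum_eq_upper_bound_imp[OF _ finite_atLeastLessThan _ j]) (rule le[OF t])
    then show "design_gap t j = y0 / (2 * lam)" by (rule eq[OF t j])
  qed
  show "crit t = crit ?t0" if "\<forall>j\<in>{1..<n}. design_gap t j = y0 / (2 * lam)"
    unfolding critK[OF t] critK[OF adm] A0 B0 using that lam pos by (simp add: N_def)
qed


section \<open>Covariances of the stationary process\<close>

text \<open>The characteristic function identifies the law as that of \<open>sqrt v\<close> times a
  standard normal variable. This comparison also covers \<open>v = 0\<close>, where there is no
  density.\<close>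

lemma (in prob_space) gaussian_moments:
  assumes X [measurable]: "X \<in> borel_measurable M" and v: "0 \<le> v"
    and char: "\<And>\<theta>. (CLINT x|M. iexp (\<theta> * X x)) = complex_of_real (exp (- (\<theta>\<^sup>2 * v) / 2))"
  shows "integrable M X" "expectation X = 0" "integrable M (\<lambda>x. (X x)\<^sup>2)" "expectation (\<lambda>x. (X x)\<^sup>2) = v"
proof -
  interpret N: real_distribution std_normal_distribution by (rule real_dist_normal_dist)
  let ?D = "distr std_normal_distribution borel (\<lambda>z. sqrt v * z)"
  have "char (distr M borel X) = char ?D"
  proof
    fix \<theta>
    have "char (distr M borel X) \<theta> = (CLINT x|M. iexp (\<theta> * X x))"
      unfolding char_def by (subst integral_distr) auto
    also have "\<dots> = char std_normal_distribution (\<theta> * sqrt v)"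
      unfolding char using v by (simp add: char_std_normal_distribution power_mult_distrib)
    also have "\<dots> = char ?D \<theta>"
      unfolding char_def by (subst integral_distr) (auto simp: mult.assoc)
    finally show "char (distr M borel X) \<theta> = char ?D \<theta>" .
  qed
  then have eq: "distr M borel X = ?D"
    by (intro Levy_uniqueness real_distribution_distr N.real_distribution_distr) auto
  have int: "integrable std_normal_distribution (\<lambda>z. (sqrt v * z) ^ k)" for k
    unfolding power_mult_distrib using integrable_std_normal_distribution_moment[of k] by simp
  have 1: "integrable M (\<lambda>x. (X x) ^ k)" for k
  proof -
    have "integrable ?D (\<lambda>z. z ^ k)" using int by (subst integrable_distr_eq) auto
    then show ?thesis unfolding eq[symmetric] by (subst (asm) integrable_distr_eq) auto
  qed
  have 2: "expectation (\<lambda>x. (X x) ^ k) = sqrt v ^ k * (LINT z|std_normal_distribution. z ^ k)" for k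
  proof -
    have "expectation (\<lambda>x. (X x) ^ k) = (LINT z|distr M borel X. z ^ k)" by (subst integral_distr) auto
    also have "\<dots> = (LINT z|std_normal_distribution. (sqrt v * z) ^ k)"
      unfolding eq by (subst integral_distr) auto
    finally show ?thesis by (simp add: power_mult_distrib)
  qed
  show "integrable M X" "integrable M (\<lambda>x. (X x)\<^sup>2)" using 1[of 1] 1[of 2] by simp_all
  show "expectation X = 0" using 2[of 1] integral_std_normal_distribution_moment_odd[of 1] by simp
  show "expectation (\<lambda>x. (X x)\<^sup>2) = v"
    using 2[of 2] std_normal_distribution_even_moments(1)[of 1] v by simp
qed

section \<open>From stationarity to second moments\<close>

locale stationary_OU =
  fixes M :: "'a measure" and lam \<omega> :: real and Y :: "real \<Rightarrow> 'a \<Rightarrow> complex"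
  assumes lam: "0 < lam" and OU: "normalized_stationary_complex_OU M lam \<omega> Y"
begin

definition rate :: complex where "rate = complex_of_real lam - \<i> * complex_of_real \<omega>"

sublocale prob_space M
  using OU by (auto simp: normalized_stationary_complex_OU_def complex_brownian_motion_def standard_brownian_motion_def)

lemma Y_measurable [measurable]: "0 \<le> t \<Longrightarrow> Y t \<in> borel_measurable M"
  using OU by (auto simp: normalized_stationary_complex_OU_def complex_OU_solution_def)

lemma char_shift:
  assumes "0 \<le> h" "0 \<le> t"
  shows "(CLINT x|M. iexp (Re (\<eta> * Y h x) + Re (\<xi> * Y (t + h) x))) =
    (CLINT x|M. iexp (Re (\<eta> * Y 0 x) + Re (\<xi> * Y t x)))"
proof -
  let ?P = "\<Pi>\<^sub>M t\<in>{0::real..}. (borel :: complex measure)"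
  let ?f = "\<lambda>p. iexp (Re (\<eta> * p 0) + Re (\<xi> * p t))"
  have [measurable]: "(\<lambda>f. f r) \<in> borel_measurable ?P" if "0 \<le> r" for r
    using that by (intro measurable_component_singleton) simp
  have f: "?f \<in> borel_measurable ?P" using assms by measurable
  have path: "(\<lambda>x. \<lambda>t\<in>{0..}. Y (t + r) x) \<in> measurable M ?P" if "0 \<le> r" for r
    using that by (intro measurable_restrict) simp
  have "(CLINT x|M. ?f (\<lambda>t\<in>{0..}. Y (t + h) x)) = (CLINT p|distr M ?P (\<lambda>x. \<lambda>t\<in>{0..}. Y (t + h) x). ?f p)"
    by (rule integral_distr[OF path[OF assms(1)] f, symmetric])
  also have "distr M ?P (\<lambda>x. \<lambda>t\<in>{0..}. Y (t + h) x) = distr M ?P (\<lambda>x. \<lambda>t\<in>{0..}. Y t x)"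
    using OU assms by (auto simp: normalized_stationary_complex_OU_def strictly_stationary_def)
  also have "(CLINT p|distr M ?P (\<lambda>x. \<lambda>t\<in>{0..}. Y t x). ?f p) = (CLINT x|M. ?f (\<lambda>t\<in>{0..}. Y t x))"
    using path[of 0] by (intro integral_distr f) simp
  finally show ?thesis using assms by simp
qed

lemma char_innovation:
  assumes "0 < t"
  shows "(CLINT x|M. iexp (Re (\<eta> * Y 0 x) + Re (\<xi> * Y t x))) =
    (CLINT x|M. iexp (Re ((\<eta> + \<xi> * exp (- rate * t)) * Y 0 x))) *
    complex_of_real (exp (- ((cmod \<xi>)\<^sup>2 * (1 - exp (- 2 * lam * t))) / 2))"
proof -
  obtain \<sigma> W where *: "0 < \<sigma>" "\<sigma>\<^sup>2 / (2 * lam) = 1" "complex_brownian_motion M W" "complex_OU_solution M lam \<omega> \<sigma> W Y"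
    using OU by (auto simp: normalized_stationary_complex_OU_def)
  have \<sigma>: "\<sigma>\<^sup>2 = 2 * lam" using *(2) lam by (simp add: field_simps)
  have "Re (\<eta> * Y 0 x) + Re (\<xi> * Y t x) =
    Re ((\<eta> + \<xi> * exp (- rate * t)) * Y 0 x) + Re (\<xi> * (Y t x - exp (- rate * t) * Y 0 x))" for x
    unfolding plus_complex.sel(1)[symmetric] by (rule arg_cong[where f = Re]) (simp add: algebra_simps)
  then show ?thesis
    using OU_char_limit[OF *(3,4) lam \<sigma> assms, of "\<eta> + \<xi> * exp (- rate * t)" \<xi>]
    unfolding rate_def[symmetric] by simp
qed

lemma norm_exp_rate: "cmod (exp (- rate * complex_of_real t)) = exp (- lam * t)"
  by (simp add: rate_def)

text \<open>As \<open>t \<rightarrow> \<infinity>\<close> in \<open>char_innovation\<close>, the initial value is forgotten.\<close>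

lemma char_marginal:
  "(CLINT x|M. iexp (Re (\<xi> * Y 0 x))) = complex_of_real (exp (- (cmod \<xi>)\<^sup>2 / 2))"
proof -
  let ?\<phi> = "\<lambda>\<xi>. CLINT x|M. iexp (Re (\<xi> * Y 0 x))"
  have step: "?\<phi> \<xi> = ?\<phi> (\<xi> * exp (- rate * complex_of_real (real (Suc k)))) *
    complex_of_real (exp (- ((cmod \<xi>)\<^sup>2 * (1 - exp (- 2 * lam * real (Suc k)))) / 2))" for k
    using char_innovation[of "real (Suc k)" 0 \<xi>] char_shift[of "real (Suc k)" 0 \<xi> 0] by simp
  have decay: "(\<lambda>k. exp (- c * real (Suc k))) \<longlonglongrightarrow> 0" if "0 < c" for c :: real
  proof -
    have "(\<lambda>k. exp (- c) ^ Suc k) \<longlonglongrightarrow> 0"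
      using that by (intro LIMSEQ_Suc LIMSEQ_power_zero) simp
    then show ?thesis by (simp only: exp_of_nat2_mult[symmetric] mult.commute mult_minus_left)
  qed
  have rate0: "(\<lambda>k. exp (- rate * complex_of_real (real (Suc k)))) \<longlonglongrightarrow> 0"
    by (rule tendsto_norm_zero_cancel) (simp only: norm_exp_rate decay[OF lam])
  have "(\<lambda>k. ?\<phi> (\<xi> * exp (- rate * complex_of_real (real (Suc k))))) \<longlonglongrightarrow> (CLINT x|M. iexp 0)"
  proof (rule integral_dominated_convergence[where w="\<lambda>_. 1"])
    show "AE x in M. (\<lambda>k. iexp (Re (\<xi> * exp (- rate * complex_of_real (real (Suc k))) * Y 0 x))) \<longlonglongrightarrow> iexp 0"
    proof (rule AE_I2)
      fix x
      have "(\<lambda>k. iexp (Re (\<xi> * exp (- rate * complex_of_real (real (Suc k))) * Y 0 x))) \<longlonglongrightarrow> iexp (Re (\<xi> * 0 * Y 0 x))"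
        by (intro tendsto_intros rate0)
      then show "(\<lambda>k. iexp (Re (\<xi> * exp (- rate * complex_of_real (real (Suc k))) * Y 0 x))) \<longlonglongrightarrow> iexp 0" by simp
    qed
  qed auto
  moreover have "(\<lambda>k. complex_of_real (exp (- ((cmod \<xi>)\<^sup>2 * (1 - exp (- (2 * lam) * real (Suc k)))) / 2)))
    \<longlonglongrightarrow> complex_of_real (exp (- ((cmod \<xi>)\<^sup>2 * (1 - 0)) / 2))"
    by (intro tendsto_intros decay) (use lam in auto)
  ultimately have "(\<lambda>k. ?\<phi> (\<xi> * exp (- rate * complex_of_real (real (Suc k)))) *
    complex_of_real (exp (- ((cmod \<xi>)\<^sup>2 * (1 - exp (- (2 * lam) * real (Suc k)))) / 2)))
    \<longlonglongrightarrow> (CLINT x|M. iexp 0) * complex_of_real (exp (- ((cmod \<xi>)\<^sup>2 * (1 - 0)) / 2))"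
    by (rule tendsto_mult)
  then have "(\<lambda>k::nat. ?\<phi> \<xi>) \<longlonglongrightarrow> (CLINT x|M. iexp 0) * complex_of_real (exp (- ((cmod \<xi>)\<^sup>2 * (1 - 0)) / 2))"
    using step by simp
  then show ?thesis by (simp add: tendsto_const_iff prob_space)
qed

text \<open>The variance of \<open>Re (\<eta> * Y h) + Re (\<xi> * Y (t + h))\<close> for
  nonnegative \<open>h\<close> and \<open>t\<close>, by \<open>pair_moments\<close>; its mixed term
  carries the covariance.\<close>

definition pair_var :: "complex \<Rightarrow> complex \<Rightarrow> real \<Rightarrow> real" where
  "pair_var \<eta> \<xi> t = (cmod \<eta>)\<^sup>2 + (cmod \<xi>)\<^sup>2 + 2 * Re (cnj \<eta> * \<xi> * exp (- rate * t))"

text \<open>Expanding the square produces \<open>(cmod \<xi>)\<^sup>2 * exp (- 2 * lam * t)\<close>,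
  which cancels against the innovation variance. The right side is the form delivered by
  \<open>char_innovation\<close>, and it is visibly nonnegative for
  \<open>t \<ge> 0\<close>.\<close>

lemma pair_var_eq:
  "pair_var \<eta> \<xi> t = (cmod (\<eta> + \<xi> * exp (- rate * t)))\<^sup>2 + (cmod \<xi>)\<^sup>2 * (1 - exp (- 2 * lam * t))"
proof -
  have cm: "(cmod (a + b))\<^sup>2 = (cmod a)\<^sup>2 + (cmod b)\<^sup>2 + 2 * Re (cnj a * b)" for a b
    unfolding cmod_power2 by (simp add: power2_eq_square algebra_simps)
  have "(exp (- lam * t))\<^sup>2 = exp (- 2 * lam * t)" by (simp flip: exp_double)
  then have norm2: "(cmod (\<xi> * exp (- rate * t)))\<^sup>2 = (cmod \<xi>)\<^sup>2 * exp (- 2 * lam * t)"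
    by (simp only: norm_mult norm_exp_rate power_mult_distrib)
  show ?thesis
    unfolding pair_var_def cm norm2 mult.assoc by (simp add: right_diff_distrib del: times_complex.sel)
qed

lemma char_pair:
  assumes "0 \<le> h" "0 \<le> t"
  shows "(CLINT x|M. iexp (Re (\<eta> * Y h x) + Re (\<xi> * Y (t + h) x))) =
    complex_of_real (exp (- pair_var \<eta> \<xi> t / 2))"
proof (cases "t = 0")
  case True
  have "(CLINT x|M. iexp (Re (\<eta> * Y h x) + Re (\<xi> * Y (t + h) x))) = (CLINT x|M. iexp (Re ((\<eta> + \<xi>) * Y 0 x)))"
    unfolding char_shift[OF assms] by (simp add: True algebra_simps)
  then show ?thesis unfolding char_marginal pair_var_eq by (simp add: True)
next
  case False
  then have t: "0 < t" using assms by simp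
  have "exp (- A / 2) * exp (- B / 2) = exp (- (A + B) / 2)" for A B :: real
    by (simp add: add_divide_distrib flip: exp_add)
  then show ?thesis
    unfolding char_shift[OF assms] char_innovation[OF t] char_marginal pair_var_eq of_real_mult[symmetric]
    by (rule arg_cong)
qed

lemma pair_moments:
  assumes "0 \<le> h" "0 \<le> t"
  shows "integrable M (\<lambda>x. Re (\<eta> * Y h x) + Re (\<xi> * Y (t + h) x))"
    and "expectation (\<lambda>x. Re (\<eta> * Y h x) + Re (\<xi> * Y (t + h) x)) = 0"
    and "integrable M (\<lambda>x. (Re (\<eta> * Y h x) + Re (\<xi> * Y (t + h) x))\<^sup>2)"
    and "expectation (\<lambda>x. (Re (\<eta> * Y h x) + Re (\<xi> * Y (t + h) x))\<^sup>2) = pair_var \<eta> \<xi> t"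
proof -
  let ?X = "\<lambda>x. Re (\<eta> * Y h x) + Re (\<xi> * Y (t + h) x)"
  have [measurable]: "Y h \<in> borel_measurable M" "Y (t + h) \<in> borel_measurable M"
    using assms by (auto intro: Y_measurable)
  have meas: "?X \<in> borel_measurable M" by measurable
  have nonneg: "0 \<le> pair_var \<eta> \<xi> t" unfolding pair_var_eq using lam assms by simp
  have char: "(CLINT x|M. iexp (\<theta> * ?X x)) = complex_of_real (exp (- (\<theta>\<^sup>2 * pair_var \<eta> \<xi> t) / 2))" for \<theta>
  proof -
    have "\<theta> * ?X x = Re (of_real \<theta> * \<eta> * Y h x) + Re (of_real \<theta> * \<xi> * Y (t + h) x)" for x
      by (simp add: algebra_simps)
    \<comment> \<open>By this homogeneity \<open>char_pair\<close> gives the characteristic function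
      of the scalar variable \<open>?X\<close> at every \<theta>.\<close>
    moreover have "pair_var (of_real \<theta> * \<eta>) (of_real \<theta> * \<xi>) t = \<theta>\<^sup>2 * pair_var \<eta> \<xi> t"
    proof -
      have "Re (cnj (of_real \<theta> * \<eta>) * (of_real \<theta> * \<xi>) * exp (- rate * t)) = \<theta>\<^sup>2 * Re (cnj \<eta> * \<xi> * exp (- rate * t))"
      proof -
        have "cnj (of_real \<theta> * \<eta>) * (of_real \<theta> * \<xi>) * exp (- rate * t) = of_real (\<theta>\<^sup>2) * (cnj \<eta> * \<xi> * exp (- rate * t))"
          by (simp add: power2_eq_square)
        then show ?thesis by (simp only: Re_complex_of_real Im_complex_of_real times_complex.sel mult_zero_left diff_0_right)
      qed
      then show ?thesis by (simp add: pair_var_def norm_mult power_mult_distrib algebra_simps)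
    qed
    ultimately show ?thesis using char_pair[OF assms, of "of_real \<theta> * \<eta>" "of_real \<theta> * \<xi>"] by simp
  qed
  from gaussian_moments[OF meas nonneg char]
  show "integrable M ?X" "expectation ?X = 0" "integrable M (\<lambda>x. (?X x)\<^sup>2)"
    "expectation (\<lambda>x. (?X x)\<^sup>2) = pair_var \<eta> \<xi> t" by blast+
qed

text \<open>Polarisation: the product is half of the square of the sum minus both squares. A zero
  coefficient in \<open>pair_moments\<close> gives the marginal terms.\<close>

lemma cross_moment_le:
  assumes "0 \<le> h" "h \<le> t"
  shows "expectation (\<lambda>x. Re (\<eta> * Y h x) * Re (\<xi> * Y t x)) = Re (cnj \<eta> * \<xi> * exp (- rate * (t - h)))"
proof -
  let ?A = "\<lambda>x. Re (\<eta> * Y h x)" and ?B = "\<lambda>x. Re (\<xi> * Y t x)"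
  have d: "0 \<le> t - h" using assms by simp
  note m = pair_moments[OF assms(1) d]
  have A: "integrable M (\<lambda>x. (?A x)\<^sup>2)" "expectation (\<lambda>x. (?A x)\<^sup>2) = (cmod \<eta>)\<^sup>2"
    using m(3,4)[of \<eta> 0] by (simp_all add: pair_var_def)
  have B: "integrable M (\<lambda>x. (?B x)\<^sup>2)" "expectation (\<lambda>x. (?B x)\<^sup>2) = (cmod \<xi>)\<^sup>2"
    using m(3,4)[of 0 \<xi>] by (simp_all add: pair_var_def)
  have S: "integrable M (\<lambda>x. (?A x + ?B x)\<^sup>2)" "expectation (\<lambda>x. (?A x + ?B x)\<^sup>2) = pair_var \<eta> \<xi> (t - h)"
    using m(3,4)[of \<eta> \<xi>] by simp_all
  have "expectation (\<lambda>x. ?A x * ?B x) = expectation (\<lambda>x. ((?A x + ?B x)\<^sup>2 - (?A x)\<^sup>2 - (?B x)\<^sup>2) / 2)"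
  proof (rule Bochner_Integration.integral_cong[OF refl])
    have "a * b = ((a + b)\<^sup>2 - a\<^sup>2 - b\<^sup>2) / 2" for a b :: real
      by (simp add: power2_eq_square algebra_simps)
    then show "?A x * ?B x = ((?A x + ?B x)\<^sup>2 - (?A x)\<^sup>2 - (?B x)\<^sup>2) / 2" for x .
  qed
  also have "\<dots> = (expectation (\<lambda>x. (?A x + ?B x)\<^sup>2) - expectation (\<lambda>x. (?A x)\<^sup>2) - expectation (\<lambda>x. (?B x)\<^sup>2)) / 2"
    using A(1) B(1) S(1) by (simp del: times_complex.sel)
  also have "\<dots> = (pair_var \<eta> \<xi> (t - h) - (cmod \<eta>)\<^sup>2 - (cmod \<xi>)\<^sup>2) / 2"
    unfolding A(2) B(2) S(2) ..
  finally show ?thesis by (simp add: pair_var_def)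
qed

lemma exp_rate: "exp (- rate * complex_of_real d) = complex_of_real (exp (- lam * d)) * cis (\<omega> * d)"
  by (simp add: rate_def exp_of_real[symmetric] cis_conv_exp mult_exp_exp algebra_simps)

lemma mean_zero: "0 \<le> t \<Longrightarrow> expectation (\<lambda>x. Re (\<xi> * Y t x)) = 0"
  and integrable_Re: "0 \<le> t \<Longrightarrow> integrable M (\<lambda>x. Re (\<xi> * Y t x))"
  using pair_moments(1,2)[of t 0 \<xi> 0] by simp_all

lemma cross_moment:
  assumes "0 \<le> r" "0 \<le> t"
  shows "expectation (\<lambda>x. Re (\<eta> * Y r x) * Re (\<xi> * Y t x)) =
    Re (\<eta> * cnj \<xi> * (complex_of_real (exp (- lam * \<bar>r - t\<bar>)) * cis (\<omega> * (r - t))))"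
proof (cases "r \<le> t")
  case True
  \<comment> \<open>Conjugation keeps the real part and turns the phase
    \<open>\<omega> * (t - r)\<close> into \<open>\<omega> * (r - t)\<close>, so both time orders
    share one formula.\<close>
  have "cnj (cnj \<eta> * \<xi> * exp (- rate * complex_of_real (t - r))) =
    \<eta> * cnj \<xi> * (complex_of_real (exp (- lam * \<bar>r - t\<bar>)) * cis (\<omega> * (r - t)))"
    unfolding exp_rate using True by (simp add: cis_cnj algebra_simps)
  then have "Re (cnj (cnj \<eta> * \<xi> * exp (- rate * complex_of_real (t - r)))) =
    Re (\<eta> * cnj \<xi> * (complex_of_real (exp (- lam * \<bar>r - t\<bar>)) * cis (\<omega> * (r - t))))"
    by (rule arg_cong)
  then show ?thesis
    unfolding cross_moment_le[OF assms(1) True] cnj.sel(1) .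
next
  case False
  then have tr: "t \<le> r" "\<bar>r - t\<bar> = r - t" by simp_all
  have "expectation (\<lambda>x. Re (\<eta> * Y r x) * Re (\<xi> * Y t x)) = expectation (\<lambda>x. Re (\<xi> * Y t x) * Re (\<eta> * Y r x))"
    by (rule Bochner_Integration.integral_cong[OF refl]) (rule mult.commute)
  also have "\<dots> = Re (cnj \<xi> * \<eta> * exp (- rate * complex_of_real (r - t)))"
    by (rule cross_moment_le[OF assms(2) tr(1)])
  finally show ?thesis unfolding exp_rate tr(2) mult.commute[of "cnj \<xi>"] .
qed

lemma covariance_OU:
  assumes "0 \<le> r" "0 \<le> t"
  shows "covariance M (\<lambda>x. Re (\<eta> * (m + Y r x))) (\<lambda>x. Re (\<xi> * (m + Y t x))) =
    Re (\<eta> * cnj \<xi> * (complex_of_real (exp (- lam * \<bar>r - t\<bar>)) * cis (\<omega> * (r - t))))"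
proof -
  have mean: "expectation (\<lambda>x. Re (\<eta> * (m + Y s x))) = Re (\<eta> * m)" if "0 \<le> s" for s \<eta>
  proof -
    have "expectation (\<lambda>x. Re (\<eta> * (m + Y s x))) = expectation (\<lambda>x. Re (\<eta> * m) + Re (\<eta> * Y s x))"
      by (simp add: distrib_left)
    also have "\<dots> = Re (\<eta> * m)"
      using integrable_Re[OF that, of \<eta>] mean_zero[OF that, of \<eta>] by (simp add: prob_space)
    finally show ?thesis .
  qed
  have "Re (\<eta> * (m + z)) - Re (\<eta> * m) = Re (\<eta> * z)" for \<eta> z by (simp add: algebra_simps)
  then show ?thesis
    unfolding covariance_def mean[OF assms(1)] mean[OF assms(2)] by (simp only: cross_moment[OF assms])
qed

lemma obs_cov_OU:
  assumes t: "\<And>p. p < n \<Longrightarrow> 0 \<le> t (p + 1)" and Z: "\<And>s x. Z s x = m + Y s x"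
  shows "obs_cov M Z n t = rotation_block_mat n (ou_kernel lam \<omega> (\<lambda>p. t (p + 1)))"
proof (rule eq_matI)
  fix i j
  assume "i < dim_row (rotation_block_mat n (ou_kernel lam \<omega> (\<lambda>p. t (p + 1))))"
    "j < dim_col (rotation_block_mat n (ou_kernel lam \<omega> (\<lambda>p. t (p + 1))))"
  then have ij: "i < 2 * n" "j < 2 * n" by simp_all
  then have pos: "0 \<le> t (i div 2 + 1)" "0 \<le> t (j div 2 + 1)" using t[of "i div 2"] t[of "j div 2"] by auto
  \<comment> \<open>Since \<open>Re (- \<i> * z) = Im z\<close>, both kinds of observation are real
    parts, and \<open>e i * cnj (e j)\<close> reproduces the sign pattern of a block.\<close>
  define e :: "nat \<Rightarrow> complex" where "e i = (if even i then 1 else - \<i>)" for i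
  have obs: "obs Z t i = (\<lambda>x. Re (e i * (m + Y (t (i div 2 + 1)) x)))" for i
    by (auto simp: obs_def fun_eq_iff e_def Z)
  have "obs_cov M Z n t $$ (i, j) = covariance M (obs Z t i) (obs Z t j)"
    using ij by (simp add: obs_cov_def)
  also have "\<dots> = Re (e i * cnj (e j) * ou_kernel lam \<omega> (\<lambda>p. t (p + 1)) (i div 2) (j div 2))"
    unfolding obs ou_kernel_def by (rule covariance_OU[OF pos])
  also have "\<dots> = rotation_block_mat n (ou_kernel lam \<omega> (\<lambda>p. t (p + 1))) $$ (i, j)"
    using ij by (simp add: rotation_block_mat_def Let_def e_def)
  finally show "obs_cov M Z n t $$ (i, j) = rotation_block_mat n (ou_kernel lam \<omega> (\<lambda>p. t (p + 1))) $$ (i, j)" .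
qed (simp_all add: obs_cov_def)

end


theorem theorem3p5:
  fixes M :: "real \<Rightarrow> real \<Rightarrow> 'a measure"
    and Y :: "real \<Rightarrow> real \<Rightarrow> real \<Rightarrow> 'a \<Rightarrow> complex"
    and m :: complex and n :: nat and lam \<omega> :: real
    and Z :: "real \<Rightarrow> real \<Rightarrow> real \<Rightarrow> 'a \<Rightarrow> complex"
    and C :: "(nat \<Rightarrow> real) \<Rightarrow> real \<Rightarrow> real \<Rightarrow> real mat"
  assumes Y: "\<And>l w. l > 0 \<Longrightarrow> w \<noteq> 0 \<Longrightarrow> normalized_stationary_complex_OU (M l w) l w (Y l w)"
    and Z: "\<And>l w s x. Z l w s x = m + Y l w s x"
    and C: "\<And>t l w. C t l w = obs_cov (M l w) (Z l w) n t"
    and "lam > 0" and "\<omega> \<noteq> 0" and "n \<ge> 2"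
  shows "(\<nexists>t. D_optimal_design n (\<lambda>t. fisher_damping (C t) lam \<omega>) t) \<and>
    (\<forall>t. D_optimal_design n (\<lambda>t. fisher_frequency (C t) lam \<omega>) t \<longleftrightarrow>
       admissible_design n t \<and>
       (\<forall>j\<in>{1..<n}. design_gap t j = 1 / lam * (Lambert_W (- 2 * exp (- 2)) / 2 + 1))) \<and>
    \<bar>(Lambert_W (- 2 * exp (- 2)) / 2 + 1) - 0.7968\<bar> < 0.00005 \<and>
    (\<exists>d0 > 0.
       (\<forall>d > 0. 1 - d - 2 * d * exp (- 2 * d) - exp (- 4 * d) = 0 \<longleftrightarrow> d = d0) \<and>
       \<bar>d0 - 0.4930\<bar> < 0.00005 \<and>
       (\<forall>t. D_optimal_design n (\<lambda>t. det (fisher_matrix (C t) lam \<omega>)) t \<longleftrightarrow>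
          admissible_design n t \<and> (\<forall>j\<in>{1..<n}. design_gap t j = d0 / lam)))"
proof -
  note lam = \<open>lam > 0\<close>
  \<comment> \<open>Needed for all positive \<open>l\<close> and nonzero \<open>w\<close>: the
    Fisher derivatives compare neighbouring parameters, whose processes live on possibly different
    measures.\<close>
  have "C t l w = rotation_block_mat n (ou_kernel l w (\<lambda>p. t (p + 1)))"
    if t: "admissible_design n t" and lw: "l > 0" "w \<noteq> 0" for t l w
  proof -
    interpret stationary_OU "M l w" l w "Y l w"
      using Y lw by unfold_locales auto
    show ?thesis unfolding C
      using admissible_design_nonneg[OF t] Z by (rule obs_cov_OU)
  qed
  note C_eq = this
  have fisher:
    "fisher_damping (C t) lam \<omega> = (\<Sum>j\<in>{1..<n}. gain_lam (2 * lam * design_gap t j)) / (2 * lam\<^sup>2)"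
    "fisher_frequency (C t) lam \<omega> = (\<Sum>j\<in>{1..<n}. gain_omega (2 * lam * design_gap t j)) / (2 * lam\<^sup>2)"
    "fisher_mixed (C t) lam \<omega> = 0"
    if t: "admissible_design n t" for t
  proof -
    \<comment> \<open>Observations are renumbered from 0, so that for \<open>1 \<le> p < n\<close>
      the gap before observation \<open>p\<close> is \<open>design_gap t p\<close>.\<close>
    interpret ou_times lam "\<lambda>p. t (p + 1)" n
      using lam t by unfold_locales (auto simp: admissible_design_def)
    have gap: "t (p + 1) - t (p - 1 + 1) = design_gap t p" if "p \<in> {1..<n}" for p
      using that by (simp add: design_gap_def)
    have sum_gap: "(\<Sum>p\<in>{1..<n}. g (2 * lam * (t (p + 1) - t (p - 1 + 1)))) =
      (\<Sum>j\<in>{1..<n}. g (2 * lam * design_gap t j))" for g :: "real \<Rightarrow> real"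
      by (rule sum.cong[OF refl]) (simp only: gap)
    show "fisher_damping (C t) lam \<omega> = (\<Sum>j\<in>{1..<n}. gain_lam (2 * lam * design_gap t j)) / (2 * lam\<^sup>2)"
      unfolding sum_gap[symmetric] by (rule fisher_information(1)) (fact \<open>\<omega> \<noteq> 0\<close> C_eq[OF t])+
    show "fisher_frequency (C t) lam \<omega> = (\<Sum>j\<in>{1..<n}. gain_omega (2 * lam * design_gap t j)) / (2 * lam\<^sup>2)"
      unfolding sum_gap[symmetric] by (rule fisher_information(2)) (fact \<open>\<omega> \<noteq> 0\<close> C_eq[OF t])+
    show "fisher_mixed (C t) lam \<omega> = 0"
      by (rule fisher_information(3)) (fact \<open>\<omega> \<noteq> 0\<close> C_eq[OF t])+
  qed
  have det: "det (fisher_matrix (C t) lam \<omega>) =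
      (\<Sum>j\<in>{1..<n}. gain_lam (2 * lam * design_gap t j)) / (2 * lam\<^sup>2) *
        ((\<Sum>j\<in>{1..<n}. gain_omega (2 * lam * design_gap t j)) / (2 * lam\<^sup>2))"
    if t: "admissible_design n t" for t
    unfolding det_fisher_matrix[OF fisher(3)[OF t]] fisher[OF t] ..
  \<comment> \<open>The gains are functions of \<open>2 * lam * d\<close>, so \<open>y1\<close> and
    \<open>y0\<close> are twice the optimal values of \<open>lam * d\<close>.\<close>
  define y1 where "y1 = Lambert_W (- 2 * exp (- 2)) + 2"
  note y1 = Lambert_W_zero[folded y1_def]
  have d1: "Lambert_W (- 2 * exp (- 2)) / 2 + 1 = y1 / 2" by (simp add: y1_def)
  obtain y0 where y0: "0 < y0" "det_score y0 = 0" "\<bar>y0 / 2 - 0.4930\<bar> < 0.00005"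
    by (rule det_score_zero)
  have root: "1 - d - 2 * d * exp (- 2 * d) - exp (- 4 * d) = 0 \<longleftrightarrow> d = y0 / 2" if "0 < d" for d
  proof -
    have "det_score (2 * d) = 2 * exp (2 * d) * (1 - d - 2 * d * exp (- 2 * d) - exp (- 4 * d))"
      unfolding det_score_alt by (simp add: algebra_simps flip: exp_double)
    then have "1 - d - 2 * d * exp (- 2 * d) - exp (- 4 * d) = 0 \<longleftrightarrow> det_score (2 * d) = 0" by simp
    also have "\<dots> \<longleftrightarrow> d = y0 / 2"
      using single_crossing_sign(2)[OF single_crossing_det_score y0(1,2), of "2 * d"] that by auto
    finally show ?thesis .
  qed
  have "\<nexists>t. D_optimal_design n (\<lambda>t. fisher_damping (C t) lam \<omega>) t"
    using \<open>n \<ge> 2\<close> lam fisher(1) by (rule no_optimal_damping)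
  moreover have "D_optimal_design n (\<lambda>t. fisher_frequency (C t) lam \<omega>) t \<longleftrightarrow>
       admissible_design n t \<and> (\<forall>j\<in>{1..<n}. design_gap t j = 1 / lam * (y1 / 2))" for t
    using optimal_frequency[OF lam y1(1,2) fisher(2)] by (simp add: mult.commute)
  moreover have "D_optimal_design n (\<lambda>t. det (fisher_matrix (C t) lam \<omega>)) t \<longleftrightarrow>
       admissible_design n t \<and> (\<forall>j\<in>{1..<n}. design_gap t j = (y0 / 2) / lam)" for t
    using optimal_det[OF \<open>n \<ge> 2\<close> lam y0(1,2) det] by simp
  ultimately show ?thesis
    unfolding d1 using y1(3) y0 root by (intro conjI allI exI[of _ "y0 / 2"]) auto
qed


end
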